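(* If $Z$ has almost surely continuous trajectories, then for all $x_0\ge0$ $$\lim_{x\to x_0}\mathcal{B}_Z^0(x)=\mathcal{B}_Z^0(x_0),$$ where the limit is taken over $x\ge0$.
   Context: Let $d\ge1$. $D$ is the space of generalised c\`adl\`ag functions $f:\mathbb{R}^d\to[0,\infty)$ (limits exist at every point within each of the $2^d$ quadrants, and $f(s)\to f(t)$ as $s\to t$ with $s\ge t$ componentwise), equipped with Skorohod's $J_1$-topology and the $\sigma$-field generated by the projections $f\mapsto f(t)$. The underlying probability space is complete and non-atomic. $Z(t),t\in\mathbb{R}^d$, is a random field with almost all sample paths in $D$ such that $\mathbb{E}\{Z(t)\}=1$ for all $t\in\mathbb{R}^d$, $\mathbb{E}\{\sup_{t\in[0,T]^d}Z(t)\}<\infty$ for all $T>0$, $\mathbb{P}\{\sup_{t\in\mathbb{R}^d}Z(t)>0\}=1$, and $Z$ is a spectral random field of a stationary max-stable random field $X$: the field $X(t)=\max_{i\ge1}\Gamma_i^{-1}Z^{(i)}(t)$, $t\in\mathbb{R}^d$, is stationary, where $\Gamma_i=\sum_{k=1}^i\mathcal{V}_k$, the $\mathcal{V}_k$ are i.i.d. unit exponential, independent of the i.i.d. copies $Z^{(i)}$ of $Z$. With $B^hZ(\cdot)=Z(\cdot-h)$, stationarity of $X$ is equivalent to $\mathbb{E}\{Z(h)F(Z)\}=\mathbb{E}\{Z(0)F(B^hZ)\}$ for all $h\in\mathbb{R}^d$ and all measurable $F:D\to[0,\infty]$ with $F(cf)=F(f)$ for all $f\in D,c>0$. The Berman function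 (with $\delta=0$) is, for $x\ge0$, $$\mathcal{B}_Z^0(x)=\lim_{T\to\infty}\frac1{T^d}\int_0^\infty\mathbb{P}\left\{\int_{[0,T]^d}\mathbb{I}(Z(t)>s)\,\lambda(dt)>x\right\}ds ,$$ where $\lambda$ is Lebesgue measure and $\mathbb{I}$ denotes an indicator; when $Z$ has almost all sample paths in $D$, $\mathbb{E}\{Z(t)\}=1$ for all $t\in\mathbb{R}^d$, $\mathbb{E}\{\sup_{t\in[0,T]^d}Z(t)\}<\infty$ for all $T>0$, $\mathbb{P}\{\sup_{t\in\mathbb{R}^d}Z(t)>0\}=1$ and the max-stable random field $X$ with spectral random field $Z$ is stationary, this limit exists and is finite. *)

theory Defs
  imports "HOL-Probability.Probability"
begin

definition nonatomic :: "'w measure \<Rightarrow> bool" where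
  "nonatomic M \<longleftrightarrow>
     (\<forall>A\<in>sets M. 0 < emeasure M A \<longrightarrow>
        (\<exists>B\<in>sets M. B \<subseteq> A \<and> 0 < emeasure M B \<and> emeasure M B < emeasure M A))"

text \<open>The \<open>2\<^sup>d\<close> quadrants at \<open>t\<close> are indexed by the set \<open>S\<close> of coordinates in which \<open>t\<close> is
  approached strictly from below; they partition the space.\<close>

definition quadrant :: "real^'n \<Rightarrow> 'n set \<Rightarrow> (real^'n) set" where
  "quadrant t S = {s. \<forall>i. if i \<in> S then s $ i < t $ i else t $ i \<le> s $ i}"

text \<open>The space \<open>D\<close>. Its \<open>\<sigma>\<close>-field is the one generated by the projections, so that being a random
  element of \<open>D\<close> means having paths in \<open>D\<close> and measurable coordinates; the Skorohod topology
  itself is not needed below.\<close>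

definition cadlag_fields :: "(real^'n \<Rightarrow> real) set" where
  "cadlag_fields =
     {f. (\<forall>t. 0 \<le> f t) \<and>
         (\<forall>t S. \<exists>l. (f \<longlongrightarrow> l) (at t within quadrant t S)) \<and>
         (\<forall>t. (f \<longlongrightarrow> f t) (at t within {s. t \<le> s}))}"

definition D_random_field :: "'w measure \<Rightarrow> (real^'n \<Rightarrow> 'w \<Rightarrow> real) \<Rightarrow> bool" where
  "D_random_field M Z \<longleftrightarrow>
     (\<forall>t. Z t \<in> borel_measurable M) \<and> (AE \<omega> in M. (\<lambda>t. Z t \<omega>) \<in> cadlag_fields)"

definition iid_copies ::
  "'w measure \<Rightarrow> (real^'n \<Rightarrow> 'w \<Rightarrow> real) \<Rightarrow> (nat \<Rightarrow> real^'n \<Rightarrow> 'w \<Rightarrow> real) \<Rightarrow> bool" where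
  "iid_copies M Z Zc \<longleftrightarrow>
     (\<forall>i. D_random_field M (Zc i)) \<and>
     (\<forall>i. distr M (\<Pi>\<^sub>M t\<in>UNIV. borel) (\<lambda>\<omega> t. Zc i t \<omega>) =
          distr M (\<Pi>\<^sub>M t\<in>UNIV. borel) (\<lambda>\<omega> t. Z t \<omega>)) \<and>
     prob_space.indep_vars M (\<lambda>i. \<Pi>\<^sub>M t\<in>UNIV. borel) (\<lambda>i \<omega> t. Zc i t \<omega>) UNIV"

text \<open>The library's \<open>indep_var\<close> only relates random elements with values in the same type.\<close>

definition indep_elements ::
  "'w measure \<Rightarrow> 'a measure \<Rightarrow> ('w \<Rightarrow> 'a) \<Rightarrow> 'b measure \<Rightarrow> ('w \<Rightarrow> 'b) \<Rightarrow> bool" where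
  "indep_elements M S X T Y \<longleftrightarrow>
     X \<in> measurable M S \<and> Y \<in> measurable M T \<and>
     prob_space.indep_set M (sets (vimage_algebra (space M) X S))
       (sets (vimage_algebra (space M) Y T))"

definition iid_unit_exponential :: "'w measure \<Rightarrow> (nat \<Rightarrow> 'w \<Rightarrow> real) \<Rightarrow> bool" where
  "iid_unit_exponential M V \<longleftrightarrow>
     (\<forall>k. distributed M lborel (V k) (exponential_density 1)) \<and>
     prob_space.indep_vars M (\<lambda>k. borel) V UNIV"

text \<open>Sequences are indexed from \<open>0\<close>, so \<open>\<Gamma>\<^sub>i\<close> is the sum of \<open>V 0, \<dots>, V i\<close>. The maximum over all \<open>i\<close>
  is written as a supremum in the extended reals; it is almost surely finite and attained.\<close>

definition max_stable_field ::
  "(nat \<Rightarrow> 'w \<Rightarrow> real) \<Rightarrow> (nat \<Rightarrow> real^'n \<Rightarrow> 'w \<Rightarrow> real) \<Rightarrow> real^'n \<Rightarrow> 'w \<Rightarrow> ereal" where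
  "max_stable_field V Zc t \<omega> = (SUP i. ereal (inverse (\<Sum>k\<le>i. V k \<omega>) * Zc i t \<omega>))"

definition stationary_field :: "'w measure \<Rightarrow> (real^'n \<Rightarrow> 'w \<Rightarrow> ereal) \<Rightarrow> bool" where
  "stationary_field M X \<longleftrightarrow>
     (\<forall>h J. finite J \<longrightarrow>
        distr M (\<Pi>\<^sub>M t\<in>J. borel) (\<lambda>\<omega>. \<lambda>t\<in>J. X (t + h) \<omega>) =
        distr M (\<Pi>\<^sub>M t\<in>J. borel) (\<lambda>\<omega>. \<lambda>t\<in>J. X t \<omega>))"

text \<open>The Berman function with \<open>\<delta> = 0\<close>. For the fields considered here the limit exists, and the
  outer integral is at most the expected supremum of \<open>Z\<close> over \<open>[0,T]\<^sup>d\<close>.\<close>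

definition berman :: "'w measure \<Rightarrow> (real^'n \<Rightarrow> 'w \<Rightarrow> real) \<Rightarrow> real \<Rightarrow> real" where
  "berman M Z x =
     Lim at_top (\<lambda>T::real. 1 / T ^ CARD('n) *
       (LBINT s:{0..}. measure M {\<omega>\<in>space M.
          x < (LBINT t:cbox 0 (vec T). indicator {u. s < Z u \<omega>} t)}))"

end

theory Submission
  imports Defs
begin

text \<open>
  Replace \<open>Z\<close> by a version all of whose paths are continuous.
  For a level \<open>s > 0\<close> and an outcome \<open>\<omega>\<close> let \<open>A (\<omega>, s) = {t. s < Z t \<omega>}\<close>. On the product \<open>P\<close> of the
  probability space with Lebesgue measure on the levels this is a random open set, and the
  numerator of the Berman function at \<open>T\<close> is the \<open>P\<close>-measure of the event that the part of
  \<open>A\<close> in the cube \<open>[0,T]\<^sup>d\<close> has volume above \<open>x\<close>. Below, \<open>E\<close> is the expectation over the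
  paths, while measures and integrals of what depends on \<open>A\<close> refer to \<open>P\<close>. The measure \<open>P\<close> is infinite,
  but \<open>t \<in> A\<close> has measure \<open>E Z t = 1\<close> for each \<open>t\<close>.

  \<^emph>\<open>Stationarity.\<close> For a finite nonempty set \<open>J\<close> the max-stable field exceeds \<open>c\<close> somewhere on \<open>J\<close> iff some
  term \<open>\<Gamma>\<^sub>i\<^sup>-\<^sup>1 max\<^sub>J Z\<^sup>(\<^sup>i\<^sup>)\<close> exceeds \<open>c\<close>. The number of such terms has mean \<open>m = E (max\<^sub>J Z)\<^sup>+ / c\<close>, and
  the mean number of pairs of them is at most \<open>m\<^sup>2\<close>, so the probability lies between \<open>m - m\<^sup>2\<close> and
  \<open>m\<close>. Letting \<open>c\<close> tend to infinity shows that the law of the max-stable field on \<open>J\<close> determines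
  \<open>E max\<^sub>J Z\<close>, which is the measure of the event that \<open>A\<close> meets \<open>J\<close>. Hence these measures do not
  change when \<open>J\<close> is shifted (lemma \<open>nn_integral_Max_shift\<close>).

  \<^emph>\<open>Palm calculus.\<close> By inclusion and exclusion the measures of the events \<open>J \<subseteq> A\<close> are shift invariant
  as well. Fubini's theorem turns them into the moments of the volume of \<open>(A - h) \<inter> C\<close> on the event
  \<open>h \<in> A\<close>, and since this volume is bounded, its law there does not depend on \<open>h\<close> (lemma
  \<open>vol_shift_eq_law\<close>). Writing the integral of \<open>v g(v)\<close>, where \<open>v\<close> is the volume of \<open>A \<inter> C\<close>, as a
  double integral of \<open>g(v)\<close>, also over the points \<open>t\<close> of \<open>A \<inter> C\<close> and moving each \<open>t\<close> to the origin gives the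
  identity \<open>mass_transport\<close>.

  \<^emph>\<open>The limit.\<close> Take \<open>C = [0,T]\<^sup>d\<close> and \<open>g(v) = 1/v\<close> for \<open>v > x\<close>. After division by \<open>T\<^sup>d\<close> the
  identity averages \<open>g\<close> of the volume of \<open>A\<close> in boxes around the origin that grow to the whole
  space. For \<open>T \<ge> 1\<close> these integrands are dominated by their value for \<open>T = 1\<close>, \<open>x = 0\<close>, whose
  integral is the measure of the event that \<open>A\<close> has positive volume in the unit cube and hence at most
  \<open>E sup Z < \<infinity>\<close>. Therefore the Berman function at \<open>x\<close> is the integral of \<open>1 / vol A\<close> on the
  event that \<open>0 \<in> A\<close> and \<open>vol A > x\<close> (theorem \<open>tendsto_cube_tail\<close>).

  \<^emph>\<open>Continuity.\<close> This integral is continuous at \<open>x\<^sub>0\<close> by dominated convergence, provided that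
  \<open>vol A\<close> has no atom at \<open>x\<^sub>0\<close> on the event \<open>0 \<in> A\<close>. There is none at \<open>0\<close>, because a nonempty
  open set has positive volume. For \<open>x\<^sub>0 > 0\<close> fix a continuous path: between two levels below its value
  at \<open>0\<close> that have finite superlevel volume the intermediate value theorem yields a nonempty
  open set, so the two volumes differ, and at most one level gives the volume \<open>x\<^sub>0\<close>
  (lemma \<open>superlevel_volume_strict_mono\<close>).
\<close>

section \<open>Expectations of functions of independent random elements\<close>

lemma (in prob_space) indep_var_imp_indep_elements:
  "indep_var S X T Y \<Longrightarrow> indep_elements M S X T Y"
  unfolding indep_elements_def indep_var_eq
  by (simp add: sets_vimage_algebra)

lemma (in prob_space) nn_integral_indep_elements:
  assumes ind: "indep_elements M S X T Y"
    and f [measurable]: "f \<in> borel_measurable (S \<Otimes>\<^sub>M T)"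
  shows "(\<integral>\<^sup>+\<omega>. f (X \<omega>, Y \<omega>) \<partial>M) = (\<integral>\<^sup>+\<omega>'. \<integral>\<^sup>+\<omega>. f (X \<omega>, Y \<omega>') \<partial>M \<partial>M)"
proof -
  have X [measurable]: "X \<in> measurable M S" and Y [measurable]: "Y \<in> measurable M T"
    and ind': "indep_set (sets (vimage_algebra (space M) X S)) (sets (vimage_algebra (space M) Y T))"
    using ind by (auto simp: indep_elements_def)
  interpret DX: prob_space "distr M S X" by (rule prob_space_distr) fact
  interpret DY: prob_space "distr M T Y" by (rule prob_space_distr) fact
  interpret D: pair_sigma_finite "distr M S X" "distr M T Y" ..
  have joint: "distr M S X \<Otimes>\<^sub>M distr M T Y = distr M (S \<Otimes>\<^sub>M T) (\<lambda>\<omega>. (X \<omega>, Y \<omega>))"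
  proof (rule pair_measure_eqI)
    fix A B assume "A \<in> sets (distr M S X)" "B \<in> sets (distr M T Y)"
    then have [measurable]: "A \<in> sets S" "B \<in> sets T" by auto
    have "prob ((X -` A \<inter> space M) \<inter> (Y -` B \<inter> space M)) =
        prob (X -` A \<inter> space M) * prob (Y -` B \<inter> space M)"
      by (rule indep_setD[OF ind']) (auto intro!: in_vimage_algebra)
    moreover have "(X -` A \<inter> space M) \<inter> (Y -` B \<inter> space M) = (\<lambda>\<omega>. (X \<omega>, Y \<omega>)) -` (A \<times> B) \<inter> space M"
      by auto
    ultimately show "emeasure (distr M S X) A * emeasure (distr M T Y) B =
        emeasure (distr M (S \<Otimes>\<^sub>M T) (\<lambda>\<omega>. (X \<omega>, Y \<omega>))) (A \<times> B)"
      by (simp add: emeasure_distr emeasure_eq_measure ennreal_mult)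
  qed (simp_all add: DX.sigma_finite_measure_axioms DY.sigma_finite_measure_axioms
      cong: sets_pair_measure_cong)
  have "(\<integral>\<^sup>+\<omega>. f (X \<omega>, Y \<omega>) \<partial>M) = (\<integral>\<^sup>+z. f z \<partial>(distr M S X \<Otimes>\<^sub>M distr M T Y))"
    unfolding joint by (subst nn_integral_distr) auto
  also have "\<dots> = (\<integral>\<^sup>+y. \<integral>\<^sup>+x. f (x, y) \<partial>distr M S X \<partial>distr M T Y)"
    by (rule D.nn_integral_snd[symmetric]) simp
  also have "\<dots> = (\<integral>\<^sup>+\<omega>'. \<integral>\<^sup>+x. f (x, Y \<omega>') \<partial>distr M S X \<partial>M)"
    by (subst nn_integral_distr) auto
  also have "\<dots> = (\<integral>\<^sup>+\<omega>'. \<integral>\<^sup>+\<omega>. f (X \<omega>, Y \<omega>') \<partial>M \<partial>M)"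
    by (intro nn_integral_cong nn_integral_distr) measurable
  finally show ?thesis .
qed

corollary (in prob_space) nn_integral_mult_indep_elements:
  fixes f g :: "_ \<Rightarrow> ennreal"
  assumes ind: "indep_elements M S X T Y"
    and [measurable]: "f \<in> borel_measurable S" "g \<in> borel_measurable T"
  shows "(\<integral>\<^sup>+\<omega>. f (X \<omega>) * g (Y \<omega>) \<partial>M) = (\<integral>\<^sup>+\<omega>. f (X \<omega>) \<partial>M) * (\<integral>\<^sup>+\<omega>. g (Y \<omega>) \<partial>M)"
proof -
  have [measurable]: "X \<in> measurable M S" "Y \<in> measurable M T"
    using ind by (auto simp: indep_elements_def)
  show ?thesis
    using nn_integral_indep_elements[OF ind, of "\<lambda>z. f (fst z) * g (snd z)"]
    by (simp add: nn_integral_multc nn_integral_cmult)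
qed

section \<open>Exceedances of a max-stable field on finite sets\<close>

definition erlang_below :: "nat \<Rightarrow> real \<Rightarrow> ennreal" where
  "erlang_below n a = (\<integral>\<^sup>+x. ennreal (erlang_density n 1 x) * indicator {..<a} x \<partial>lborel)"

lemma measurable_erlang_below [measurable]: "erlang_below n \<in> borel_measurable borel"
proof -
  have [measurable]: "Measurable.pred (borel \<Otimes>\<^sub>M lborel) (\<lambda>z. snd z \<in> {..<fst z :: real})"
    by (simp add: lessThan_def)
  show ?thesis unfolding erlang_below_def[abs_def] by measurable
qed

text \<open>The arrival times form a Poisson process with unit rate: on the half line the gamma densities
  add up to the constant \<open>1\<close>, by the exponential series.\<close>

lemma suminf_erlang_below: "(\<Sum>n. erlang_below n a) = ennreal a"
proof -
  have "(\<Sum>n. ennreal (erlang_density n 1 x)) = indicator {0..} x" for x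
  proof (cases "0 \<le> x")
    case True
    have "(\<lambda>n. x ^ n /\<^sub>R fact n) sums exp x" by (rule exp_converges)
    then have "(\<lambda>n. exp (- x) * (x ^ n /\<^sub>R fact n)) sums (exp (- x) * exp x)"
      by (rule sums_mult)
    also have "(\<lambda>n. exp (- x) * (x ^ n /\<^sub>R fact n)) = (\<lambda>n. erlang_density n 1 x)"
      using True by (auto simp: erlang_density_def field_simps)
    finally have "(\<lambda>n. erlang_density n 1 x) sums 1" by (simp add: exp_add[symmetric])
    then show ?thesis
      using True by (subst suminf_ennreal2) (auto simp: sums_iff)
  qed (simp add: erlang_density_def)
  then have "(\<Sum>n. erlang_below n a) = (\<integral>\<^sup>+x. indicator {0..} x * indicator {..<a} x \<partial>lborel)"
    unfolding erlang_below_def by (subst nn_integral_suminf[symmetric]) auto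
  also have "\<dots> = (\<integral>\<^sup>+x. indicator {0..<a} x \<partial>lborel)"
    by (intro nn_integral_cong) (auto split: split_indicator)
  also have "\<dots> = ennreal a"
    by (cases "0 \<le> a") (auto simp: ennreal_neg)
  finally show ?thesis .
qed

lemma (in prob_space) emeasure_sum_exponential_less:
  assumes "iid_unit_exponential M V" "finite I" "card I = Suc n"
  shows "emeasure M {\<omega>\<in>space M. (\<Sum>k\<in>I. V k \<omega>) < a} = erlang_below n a"
proof -
  have "distributed M lborel (\<lambda>\<omega>. \<Sum>k\<in>I. V k \<omega>) (erlang_density (card I - 1) 1)"
    using assms by (intro exponential_distributed_sum)
      (auto simp: iid_unit_exponential_def intro: indep_vars_subset)
  from distributed_emeasure[OF this, of "{..<a}"] show ?thesis
    using assms(3) by (simp add: erlang_below_def vimage_def Int_def conj_commute)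
qed

locale spectral_representation = prob_space M for M :: "'w measure" +
  fixes Z :: "real^'n \<Rightarrow> 'w \<Rightarrow> real"
    and V :: "nat \<Rightarrow> 'w \<Rightarrow> real"
    and Zc :: "nat \<Rightarrow> real^'n \<Rightarrow> 'w \<Rightarrow> real"
  assumes Z_measurable [measurable]: "Z t \<in> borel_measurable M"
    and exponential: "iid_unit_exponential M V"
    and copies: "iid_copies M Z Zc"
    and V_indep_Zc: "indep_elements M
           (\<Pi>\<^sub>M k\<in>UNIV. borel) (\<lambda>\<omega> k. V k \<omega>)
           (\<Pi>\<^sub>M i\<in>UNIV. \<Pi>\<^sub>M t\<in>UNIV. borel) (\<lambda>\<omega> i t. Zc i t \<omega>)"
begin

abbreviation arrival :: "nat \<Rightarrow> 'w \<Rightarrow> real" where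
  "arrival i \<omega> \<equiv> \<Sum>k\<le>i. V k \<omega>"

lemma V_measurable [measurable]: "V k \<in> borel_measurable M"
  using exponential by (auto simp: iid_unit_exponential_def indep_vars_def)

lemma Zc_measurable [measurable]: "Zc i t \<in> borel_measurable M"
  using copies by (auto simp: iid_copies_def D_random_field_def)

lemma AE_V_pos: "AE \<omega> in M. \<forall>k. 0 < V k \<omega>"
proof (subst AE_all_countable, intro allI)
  fix k
  have "AE x in lborel. x \<noteq> (0::real)" by (rule AE_lborel_singleton)
  then have "AE x in lborel. 0 < ennreal (exponential_density 1 x) \<longrightarrow> 0 < x"
    by eventually_elim (auto simp: exponential_density_def)
  then show "AE \<omega> in M. 0 < V k \<omega>"
    using exponential unfolding iid_unit_exponential_def
    by (subst distributed_AE2[where P = "\<lambda>x. 0 < x" and X = "V k"]) auto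
qed

lemma AE_arrival_pos: "AE \<omega> in M. \<forall>i. 0 < arrival i \<omega>"
  using AE_V_pos by eventually_elim (auto intro!: sum_pos)

lemma Z_path_measurable [measurable]: "(\<lambda>\<omega> t. Z t \<omega>) \<in> measurable M (\<Pi>\<^sub>M t\<in>UNIV. borel)"
  by (rule measurable_PiM_single') auto

lemma Zc_path_measurable [measurable]: "(\<lambda>\<omega> t. Zc i t \<omega>) \<in> measurable M (\<Pi>\<^sub>M t\<in>UNIV. borel)"
  by (rule measurable_PiM_single') auto

lemma nn_integral_copy:
  assumes [measurable]: "g \<in> borel_measurable (\<Pi>\<^sub>M t\<in>UNIV. borel)"
  shows "(\<integral>\<^sup>+\<omega>. g (\<lambda>t. Zc i t \<omega>) \<partial>M) = (\<integral>\<^sup>+\<omega>. g (\<lambda>t. Z t \<omega>) \<partial>M)"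
proof -
  have "(\<integral>\<^sup>+\<omega>. g (\<lambda>t. Zc i t \<omega>) \<partial>M) = (\<integral>\<^sup>+z. g z \<partial>distr M (\<Pi>\<^sub>M t\<in>UNIV. borel) (\<lambda>\<omega> t. Zc i t \<omega>))"
    by (subst nn_integral_distr) auto
  also have "\<dots> = (\<integral>\<^sup>+z. g z \<partial>distr M (\<Pi>\<^sub>M t\<in>UNIV. borel) (\<lambda>\<omega> t. Z t \<omega>))"
    using copies by (simp add: iid_copies_def)
  also have "\<dots> = (\<integral>\<^sup>+\<omega>. g (\<lambda>t. Z t \<omega>) \<partial>M)"
    by (subst nn_integral_distr) auto
  finally show ?thesis .
qed

text \<open>In the application \<open>\<phi>\<close> is the maximum of a path over a finite set. The index \<open>n\<close> in
  \<open>exceedance_prob\<close> stands for an arrival time that is a sum of \<open>n + 1\<close> exponential variables.\<close>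

context
  fixes \<phi> :: "(real^'n \<Rightarrow> real) \<Rightarrow> real" and c :: real
  assumes \<phi> [measurable]: "\<phi> \<in> borel_measurable (\<Pi>\<^sub>M t\<in>UNIV. borel)"
    and c: "0 < c"
begin

abbreviation exceedance :: "nat \<Rightarrow> 'w set" where
  "exceedance i \<equiv> {\<omega>\<in>space M. c * arrival i \<omega> < \<phi> (\<lambda>t. Zc i t \<omega>)}"

abbreviation exceedance_prob :: "nat \<Rightarrow> ennreal" where
  "exceedance_prob n \<equiv> \<integral>\<^sup>+\<omega>. erlang_below n (\<phi> (\<lambda>t. Z t \<omega>) / c) \<partial>M"

abbreviation mean_exceedances :: ennreal where
  "mean_exceedances \<equiv> \<integral>\<^sup>+\<omega>. ennreal (\<phi> (\<lambda>t. Z t \<omega>) / c) \<partial>M"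

lemma suminf_exceedance_prob: "(\<Sum>n. exceedance_prob n) = mean_exceedances"
  by (subst nn_integral_suminf[symmetric]) (auto simp: suminf_erlang_below)

lemma emeasure_exceedance: "emeasure M (exceedance i) = exceedance_prob i"
proof -
  let ?f = "\<lambda>z. indicator {z. c * (\<Sum>k\<le>i. fst z k) < \<phi> (snd z i)} z :: ennreal"
  have "emeasure M (exceedance i) = (\<integral>\<^sup>+\<omega>. indicator (exceedance i) \<omega> \<partial>M)"
    by simp
  also have "\<dots> = (\<integral>\<^sup>+\<omega>. ?f ((\<lambda>k. V k \<omega>), (\<lambda>j t. Zc j t \<omega>)) \<partial>M)"
    by (intro nn_integral_cong) (auto split: split_indicator)
  also have "\<dots> = (\<integral>\<^sup>+\<omega>'. \<integral>\<^sup>+\<omega>. ?f ((\<lambda>k. V k \<omega>), (\<lambda>j t. Zc j t \<omega>')) \<partial>M \<partial>M)"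
    by (rule nn_integral_indep_elements[OF V_indep_Zc]) measurable
  also have "\<dots> = (\<integral>\<^sup>+\<omega>'. emeasure M {\<omega>\<in>space M. arrival i \<omega> < \<phi> (\<lambda>t. Zc i t \<omega>') / c} \<partial>M)"
  proof (rule nn_integral_cong)
    fix \<omega>'
    have "(\<integral>\<^sup>+\<omega>. ?f ((\<lambda>k. V k \<omega>), (\<lambda>j t. Zc j t \<omega>')) \<partial>M) =
        (\<integral>\<^sup>+\<omega>. indicator {\<omega>\<in>space M. arrival i \<omega> < \<phi> (\<lambda>t. Zc i t \<omega>') / c} \<omega> \<partial>M)"
      using c by (intro nn_integral_cong) (auto simp: field_simps split: split_indicator)
    then show "(\<integral>\<^sup>+\<omega>. ?f ((\<lambda>k. V k \<omega>), (\<lambda>j t. Zc j t \<omega>')) \<partial>M) =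
        emeasure M {\<omega>\<in>space M. arrival i \<omega> < \<phi> (\<lambda>t. Zc i t \<omega>') / c}"
      by simp
  qed
  also have "\<dots> = (\<integral>\<^sup>+\<omega>'. erlang_below i (\<phi> (\<lambda>t. Zc i t \<omega>') / c) \<partial>M)"
    by (simp add: emeasure_sum_exponential_less[OF exponential])
  also have "\<dots> = exceedance_prob i"
    by (rule nn_integral_copy[of "\<lambda>z. erlang_below i (\<phi> z / c)"]) measurable
  finally show ?thesis .
qed

text \<open>Since \<open>\<Gamma>\<^sub>i \<ge> 0\<close>, the later exceedance persists when its arrival time is replaced by the gap
  \<open>\<Gamma>\<^sub>j - \<Gamma>\<^sub>i\<close>, which is independent of \<open>\<Gamma>\<^sub>i\<close> and distributed like \<open>\<Gamma>\<^sub>n\<close> with \<open>n = j - i - 1\<close>. So the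
  expected number of pairs is at most the square of the expected number of exceedances.\<close>

lemma emeasure_two_exceedances:
  "emeasure M (exceedance i \<inter> exceedance (i + Suc n)) \<le> exceedance_prob i * exceedance_prob n"
proof -
  define gap where "gap \<omega> = (\<Sum>k\<in>{i<..i + Suc n}. V k \<omega>)" for \<omega>
  have [measurable]: "gap \<in> borel_measurable M" unfolding gap_def[abs_def] by measurable
  let ?W = "\<lambda>j \<omega>. \<phi> (\<lambda>t. Zc j t \<omega>)"
  let ?f = "\<lambda>z. indicator {z. c * (\<Sum>k\<le>i. fst z k) < \<phi> (snd z i) \<and>
      c * (\<Sum>k\<in>{i<..i + Suc n}. fst z k) < \<phi> (snd z (i + Suc n))} z :: ennreal"
  have arrival_gap: "arrival (i + Suc n) \<omega> = arrival i \<omega> + gap \<omega>" for \<omega>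
  proof -
    have "{..i + Suc n} = {..i} \<union> {i<..i + Suc n}" by auto
    then show ?thesis
      unfolding gap_def by (simp only:) (rule sum.union_disjoint; auto)
  qed
  have "indep_var (PiM {..i} (\<lambda>_. borel)) (\<lambda>\<omega>. \<lambda>k\<in>{..i}. V k \<omega>)
      (PiM {i<..i + Suc n} (\<lambda>_. borel)) (\<lambda>\<omega>. \<lambda>k\<in>{i<..i + Suc n}. V k \<omega>)"
    using exponential unfolding iid_unit_exponential_def
    by (intro indep_var_restrict[where I = UNIV]) auto
  then have "indep_var borel ((\<lambda>z. \<Sum>k\<in>{..i}. z k) \<circ> (\<lambda>\<omega>. \<lambda>k\<in>{..i}. V k \<omega>))
      borel ((\<lambda>z. \<Sum>k\<in>{i<..i + Suc n}. z k) \<circ> (\<lambda>\<omega>. \<lambda>k\<in>{i<..i + Suc n}. V k \<omega>))"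
    by (rule indep_var_compose) measurable
  then have indV: "indep_elements M borel (arrival i) borel gap"
    by (intro indep_var_imp_indep_elements) (simp add: comp_def gap_def[abs_def])
  have "indep_vars (\<lambda>_. borel) (\<lambda>j. \<phi> \<circ> (\<lambda>\<omega> t. Zc j t \<omega>)) UNIV"
    using copies unfolding iid_copies_def by (intro indep_vars_compose) auto
  then have "indep_var (PiM {i} (\<lambda>_. borel)) (\<lambda>\<omega>. \<lambda>j\<in>{i}. (\<phi> \<circ> (\<lambda>\<omega> t. Zc j t \<omega>)) \<omega>)
      (PiM {i + Suc n} (\<lambda>_. borel)) (\<lambda>\<omega>. \<lambda>j\<in>{i + Suc n}. (\<phi> \<circ> (\<lambda>\<omega> t. Zc j t \<omega>)) \<omega>)"
    by (rule indep_var_restrict[where I = UNIV]) auto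
  then have "indep_var borel ((\<lambda>z. z i) \<circ> (\<lambda>\<omega>. \<lambda>j\<in>{i}. (\<phi> \<circ> (\<lambda>\<omega> t. Zc j t \<omega>)) \<omega>))
      borel ((\<lambda>z. z (i + Suc n)) \<circ> (\<lambda>\<omega>. \<lambda>j\<in>{i + Suc n}. (\<phi> \<circ> (\<lambda>\<omega> t. Zc j t \<omega>)) \<omega>))"
    by (rule indep_var_compose) (rule measurable_component_singleton; simp)+
  then have indZ: "indep_elements M borel (?W i) borel (?W (i + Suc n))"
    by (intro indep_var_imp_indep_elements) (simp add: comp_def)
  have "emeasure M (exceedance i \<inter> exceedance (i + Suc n)) \<le>
      emeasure M {\<omega>\<in>space M. c * arrival i \<omega> < ?W i \<omega> \<and> c * gap \<omega> < ?W (i + Suc n) \<omega>}"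
  proof (rule emeasure_mono_AE)
    show "AE \<omega> in M. \<omega> \<in> exceedance i \<inter> exceedance (i + Suc n) \<longrightarrow>
        \<omega> \<in> {\<omega>\<in>space M. c * arrival i \<omega> < ?W i \<omega> \<and> c * gap \<omega> < ?W (i + Suc n) \<omega>}"
      using AE_arrival_pos
    proof eventually_elim
      case (elim \<omega>)
      have "c * gap \<omega> < c * arrival (i + Suc n) \<omega>"
        using elim[rule_format, of i] c by (simp only: arrival_gap) simp
      then show ?case by auto
    qed
  qed measurable
  also have "\<dots> = (\<integral>\<^sup>+\<omega>. indicator {\<omega>\<in>space M. c * arrival i \<omega> < ?W i \<omega> \<and>
      c * gap \<omega> < ?W (i + Suc n) \<omega>} \<omega> \<partial>M)"
    by (rule nn_integral_indicator[symmetric]) measurable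
  also have "\<dots> = (\<integral>\<^sup>+\<omega>. ?f ((\<lambda>k. V k \<omega>), (\<lambda>j t. Zc j t \<omega>)) \<partial>M)"
    by (intro nn_integral_cong) (simp add: gap_def indicator_def)
  also have "\<dots> = (\<integral>\<^sup>+\<omega>'. \<integral>\<^sup>+\<omega>. ?f ((\<lambda>k. V k \<omega>), (\<lambda>j t. Zc j t \<omega>')) \<partial>M \<partial>M)"
    by (rule nn_integral_indep_elements[OF V_indep_Zc]) measurable
  also have "\<dots> = (\<integral>\<^sup>+\<omega>'. \<integral>\<^sup>+\<omega>. indicator {..<?W i \<omega>' / c} (arrival i \<omega>) *
      indicator {..<?W (i + Suc n) \<omega>' / c} (gap \<omega>) \<partial>M \<partial>M)"
    using c by (intro nn_integral_cong) (auto simp: gap_def field_simps split: split_indicator)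
  also have "\<dots> = (\<integral>\<^sup>+\<omega>'. (\<integral>\<^sup>+\<omega>. indicator {..<?W i \<omega>' / c} (arrival i \<omega>) \<partial>M) *
      (\<integral>\<^sup>+\<omega>. indicator {..<?W (i + Suc n) \<omega>' / c} (gap \<omega>) \<partial>M) \<partial>M)"
    by (intro nn_integral_cong nn_integral_mult_indep_elements[OF indV]) measurable
  also have "\<dots> = (\<integral>\<^sup>+\<omega>'. erlang_below i (?W i \<omega>' / c) * erlang_below n (?W (i + Suc n) \<omega>' / c) \<partial>M)"
  proof -
    have "(\<integral>\<^sup>+\<omega>. indicator {..<a} (\<Sum>k\<in>I. V k \<omega>) \<partial>M) = erlang_below m a"
      if "finite I" "card I = Suc m" for I m a
    proof -
      have "(\<integral>\<^sup>+\<omega>. indicator {..<a} (\<Sum>k\<in>I. V k \<omega>) \<partial>M) =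
          (\<integral>\<^sup>+\<omega>. indicator {\<omega>\<in>space M. (\<Sum>k\<in>I. V k \<omega>) < a} \<omega> \<partial>M)"
        by (intro nn_integral_cong) (auto split: split_indicator)
      then show ?thesis
        using emeasure_sum_exponential_less[OF exponential that] by simp
    qed
    then show ?thesis by (simp add: gap_def)
  qed
  also have "\<dots> = (\<integral>\<^sup>+\<omega>'. erlang_below i (?W i \<omega>' / c) \<partial>M) *
      (\<integral>\<^sup>+\<omega>'. erlang_below n (?W (i + Suc n) \<omega>' / c) \<partial>M)"
    by (rule nn_integral_mult_indep_elements[OF indZ,
          of "\<lambda>w. erlang_below i (w / c)" "\<lambda>w. erlang_below n (w / c)"]) measurable
  also have "\<dots> = exceedance_prob i * exceedance_prob n"
    by (intro arg_cong2[where f = "(*)"]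
        nn_integral_copy[of "\<lambda>z. erlang_below i (\<phi> z / c)"]
        nn_integral_copy[of "\<lambda>z. erlang_below n (\<phi> z / c)"]) measurable
  finally show ?thesis .
qed

lemma emeasure_some_exceedance_le: "emeasure M (\<Union>i. exceedance i) \<le> mean_exceedances"
  using emeasure_subadditive_countably[of exceedance M]
  by (simp add: emeasure_exceedance suminf_exceedance_prob image_subset_iff)

text \<open>A Bonferroni inequality: if the first exceedance has index \<open>i\<close>, then the number of exceedances
  is \<open>1\<close> plus the number of pairs that contain \<open>i\<close>.\<close>

lemma emeasure_some_exceedance_ge:
  "mean_exceedances \<le> emeasure M (\<Union>i. exceedance i) + mean_exceedances * mean_exceedances"
proof -
  have count: "(\<Sum>i. indicator (exceedance i) \<omega>) \<le> indicator (\<Union>i. exceedance i) \<omega> +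
      (\<Sum>i. \<Sum>n. indicator (exceedance i \<inter> exceedance (i + Suc n)) \<omega> :: ennreal)" for \<omega>
  proof (cases "\<exists>i. \<omega> \<in> exceedance i")
    case True
    define i where "i = (LEAST i. \<omega> \<in> exceedance i)"
    have i: "\<omega> \<in> exceedance i" unfolding i_def using True by (rule LeastI_ex)
    have least: "\<omega> \<notin> exceedance j" if "j < i" for j
      using that unfolding i_def by (rule not_less_Least)
    have "(\<Sum>j. indicator (exceedance j) \<omega> :: ennreal) =
        (\<Sum>n. indicator (exceedance (n + Suc i)) \<omega>) + (\<Sum>j<Suc i. indicator (exceedance j) \<omega>)"
      by (rule suminf_offset) simp
    also have "(\<Sum>j<Suc i. indicator (exceedance j) \<omega> :: ennreal) = indicator (\<Union>i. exceedance i) \<omega>"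
    proof -
      have "(\<Sum>j<i. indicator (exceedance j) \<omega> :: ennreal) = 0"
        using least by (intro sum.neutral) (simp add: indicator_def)
      moreover have "indicator (exceedance i) \<omega> = (1 :: ennreal)" "indicator (\<Union>i. exceedance i) \<omega> = (1 :: ennreal)"
        using i by (simp_all only: indicator_def UN_iff) auto
      ultimately show ?thesis by (simp only: sum.lessThan_Suc) simp
    qed
    also have "(\<Sum>n. indicator (exceedance (n + Suc i)) \<omega> :: ennreal) =
        (\<Sum>n. indicator (exceedance i \<inter> exceedance (i + Suc n)) \<omega>)"
      using i by (intro suminf_cong) (simp only: indicator_inter_arith, simp add: add.commute)
    finally have "(\<Sum>j. indicator (exceedance j) \<omega> :: ennreal) =
        indicator (\<Union>i. exceedance i) \<omega> + (\<Sum>n. indicator (exceedance i \<inter> exceedance (i + Suc n)) \<omega>)"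
      by (simp only: add.commute)
    also have "\<dots> \<le> indicator (\<Union>i. exceedance i) \<omega> +
        (\<Sum>i. \<Sum>n. indicator (exceedance i \<inter> exceedance (i + Suc n)) \<omega>)"
      using sum_le_suminf[of "\<lambda>i. \<Sum>n. indicator (exceedance i \<inter> exceedance (i + Suc n)) \<omega> :: ennreal" "{i}"]
      by (intro add_left_mono) simp
    finally show ?thesis .
  next
    case False
    then have "indicator (exceedance i) \<omega> = (0 :: ennreal)" for i
      by (simp only: indicator_def) simp
    then show ?thesis by (simp only: suminf_zero) simp
  qed
  have "mean_exceedances = (\<integral>\<^sup>+\<omega>. (\<Sum>i. indicator (exceedance i) \<omega>) \<partial>M)"
    by (subst nn_integral_suminf) (auto simp: emeasure_exceedance suminf_exceedance_prob)
  also have "\<dots> \<le> (\<integral>\<^sup>+\<omega>. indicator (\<Union>i. exceedance i) \<omega> +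
      (\<Sum>i. \<Sum>n. indicator (exceedance i \<inter> exceedance (i + Suc n)) \<omega>) \<partial>M)"
    by (intro nn_integral_mono count)
  also have "\<dots> = emeasure M (\<Union>i. exceedance i) +
      (\<Sum>i. \<Sum>n. emeasure M (exceedance i \<inter> exceedance (i + Suc n)))"
    by (subst nn_integral_add) (auto simp: nn_integral_suminf)
  also have "\<dots> \<le> emeasure M (\<Union>i. exceedance i) + (\<Sum>i. \<Sum>n. exceedance_prob i * exceedance_prob n)"
    by (intro add_left_mono suminf_le emeasure_two_exceedances) auto
  also have "(\<Sum>i. \<Sum>n. exceedance_prob i * exceedance_prob n) = mean_exceedances * mean_exceedances"
    by (simp add: ennreal_suminf_cmult ennreal_suminf_multc suminf_exceedance_prob)
  finally show ?thesis .
qed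

end

lemma max_stable_field_measurable [measurable]: "max_stable_field V Zc t \<in> borel_measurable M"
  unfolding max_stable_field_def[abs_def] by measurable

lemma measurable_Max_path [measurable]:
  assumes "finite J"
  shows "(\<lambda>z :: real^'n \<Rightarrow> real. Max ((\<lambda>t. z (t + h)) ` J)) \<in> borel_measurable (\<Pi>\<^sub>M t\<in>UNIV. borel)"
  using assms by (intro borel_measurable_Max measurable_component_singleton) auto

lemma emeasure_max_stable_exceeds:
  assumes J: "finite J" "J \<noteq> {}" and c: "0 < c"
  shows "emeasure M {\<omega>\<in>space M. \<exists>t\<in>J. ereal c < max_stable_field V Zc (t + h) \<omega>} =
    emeasure M (\<Union>i. {\<omega>\<in>space M. c * arrival i \<omega> < Max ((\<lambda>t. Zc i (t + h) \<omega>) ` J)})"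
proof (rule emeasure_eq_AE)
  show "AE \<omega> in M. \<omega> \<in> {\<omega>\<in>space M. \<exists>t\<in>J. ereal c < max_stable_field V Zc (t + h) \<omega>} \<longleftrightarrow>
    \<omega> \<in> (\<Union>i. {\<omega>\<in>space M. c * arrival i \<omega> < Max ((\<lambda>t. Zc i (t + h) \<omega>) ` J)})"
    using AE_arrival_pos
  proof eventually_elim
    case (elim \<omega>)
    then have "c < inverse (arrival i \<omega>) * Zc i t \<omega> \<longleftrightarrow> c * arrival i \<omega> < Zc i t \<omega>" for i t
      by (simp add: field_simps)
    moreover have "c * arrival i \<omega> < Max ((\<lambda>t. Zc i (t + h) \<omega>) ` J) \<longleftrightarrow>
        (\<exists>t\<in>J. c * arrival i \<omega> < Zc i (t + h) \<omega>)" for i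
      using J by (subst Max_gr_iff) auto
    ultimately show ?case
      by (auto simp: max_stable_field_def less_SUP_iff)
  qed
  have [measurable]: "(\<lambda>\<omega>. Max ((\<lambda>t. Zc i (t + h) \<omega>) ` J)) \<in> borel_measurable M" for i
    using J by (intro borel_measurable_Max) auto
  show "(\<Union>i. {\<omega>\<in>space M. c * arrival i \<omega> < Max ((\<lambda>t. Zc i (t + h) \<omega>) ` J)}) \<in> sets M"
    by measurable
  show "{\<omega>\<in>space M. \<exists>t\<in>J. ereal c < max_stable_field V Zc (t + h) \<omega>} \<in> sets M"
    using J countable_finite[of J] by measurable
qed

lemma nn_integral_Max_bounds:
  assumes J: "finite J" "J \<noteq> {}" and c: "0 < c"
  defines "m h \<equiv> (\<integral>\<^sup>+\<omega>. ennreal (Max ((\<lambda>t. Z (t + h) \<omega>) ` J) / c) \<partial>M)"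
    and "p h \<equiv> emeasure M {\<omega>\<in>space M. \<exists>t\<in>J. ereal c < max_stable_field V Zc (t + h) \<omega>}"
  shows "p h \<le> m h" and "m h \<le> p h + m h * m h"
  using emeasure_some_exceedance_le[OF measurable_Max_path[OF J(1)] c, of h]
    emeasure_some_exceedance_ge[OF measurable_Max_path[OF J(1)] c, of h]
  unfolding m_def p_def emeasure_max_stable_exceeds[OF J c] by simp_all

text \<open>With \<open>a\<close> and \<open>b\<close> the two sides, stationarity and the two bounds on the exceedance probability
  give \<open>a/c - (a/c)\<^sup>2 \<le> b/c\<close> for every level \<open>c\<close>; multiply by \<open>c\<close> and let it tend to infinity.\<close>

lemma nn_integral_Max_le_shift:
  assumes stat: "stationary_field M (max_stable_field V Zc)"
    and J: "finite J" "J \<noteq> {}"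
    and int: "\<And>t. integrable M (Z t)"
  shows "(\<integral>\<^sup>+\<omega>. ennreal (Max ((\<lambda>t. Z (t + h) \<omega>) ` J)) \<partial>M) \<le>
    (\<integral>\<^sup>+\<omega>. ennreal (Max ((\<lambda>t. Z (t + h') \<omega>) ` J)) \<partial>M)" (is "?a h \<le> ?a h'")
proof -
  let ?X = "max_stable_field V Zc"
  have p_eq: "emeasure M {\<omega>\<in>space M. \<exists>t\<in>J. ereal c < ?X (t + g) \<omega>} =
      emeasure M {\<omega>\<in>space M. \<exists>t\<in>J. ereal c < ?X t \<omega>}" for g c
  proof -
    let ?S = "{x \<in> space (\<Pi>\<^sub>M t\<in>J. borel). \<exists>t\<in>J. ereal c < x t}"
    have S: "?S \<in> sets (\<Pi>\<^sub>M t\<in>J. borel)"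
      using J countable_finite[of J] by measurable
    have "emeasure M {\<omega>\<in>space M. \<exists>t\<in>J. ereal c < ?X (t + g) \<omega>} =
        emeasure (distr M (\<Pi>\<^sub>M t\<in>J. borel) (\<lambda>\<omega>. \<lambda>t\<in>J. ?X (t + g) \<omega>)) ?S" for g
      by (subst emeasure_distr[OF _ S]; (intro arg_cong[where f = "emeasure M"])?)
        (auto simp: space_PiM)
    from this[of g] this[of 0] show ?thesis
      using stat J by (simp add: stationary_field_def)
  qed
  have fin: "?a g < \<infinity>" for g
  proof -
    have "?a g \<le> (\<integral>\<^sup>+\<omega>. (\<Sum>t\<in>J. ennreal (norm (Z (t + g) \<omega>))) \<partial>M)"
    proof (rule nn_integral_mono)
      fix \<omega>
      have "Max ((\<lambda>t. Z (t + g) \<omega>) ` J) \<in> (\<lambda>t. Z (t + g) \<omega>) ` J"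
        using J by (intro Max_in) auto
      then obtain t where t: "t \<in> J" "Max ((\<lambda>t. Z (t + g) \<omega>) ` J) = Z (t + g) \<omega>" by auto
      have "ennreal (Z (t + g) \<omega>) \<le> ennreal (norm (Z (t + g) \<omega>))" by (intro ennreal_leI) simp
      also have "\<dots> \<le> (\<Sum>t\<in>J. ennreal (norm (Z (t + g) \<omega>)))"
        using J t by (intro member_le_sum) auto
      finally show "ennreal (Max ((\<lambda>t. Z (t + g) \<omega>) ` J)) \<le> (\<Sum>t\<in>J. ennreal (norm (Z (t + g) \<omega>)))"
        using t by simp
    qed
    also have "\<dots> < \<infinity>"
      using int J by (subst nn_integral_sum) (auto simp: integrable_iff_bounded)
    finally show ?thesis .
  qed
  define a b where "a = enn2real (?a h)" and "b = enn2real (?a h')"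
  have a: "?a h = ennreal a" and b: "?a h' = ennreal b" and "0 \<le> a" "0 \<le> b"
    using fin[of h] fin[of h'] by (auto simp: a_def b_def)
  have scaled: "(\<integral>\<^sup>+\<omega>. ennreal (Max ((\<lambda>t. Z (t + g) \<omega>) ` J) / c) \<partial>M) = ?a g * ennreal (1 / c)"
    if "0 < c" for c g
  proof -
    have [measurable]: "(\<lambda>\<omega>. Max ((\<lambda>t. Z (t + g) \<omega>) ` J)) \<in> borel_measurable M"
      using J by (intro borel_measurable_Max) auto
    show ?thesis
      using that by (subst nn_integral_multc[symmetric]) (auto simp: ennreal_mult''[symmetric])
  qed
  have "a - a\<^sup>2 / c \<le> b" if c: "0 < c" for c
  proof -
    have "?a h * ennreal (1 / c) \<le> ?a h' * ennreal (1 / c) + ?a h * ennreal (1 / c) * (?a h * ennreal (1 / c))"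
      using nn_integral_Max_bounds(2)[OF J c, of h] nn_integral_Max_bounds(1)[OF J c, of h']
      unfolding scaled[OF c] p_eq by (meson add_right_mono order_trans)
    then have "a * (1 / c) \<le> b * (1 / c) + a * (1 / c) * (a * (1 / c))"
      unfolding a b using \<open>0 \<le> a\<close> \<open>0 \<le> b\<close> c
      by (simp add: ennreal_mult[symmetric] ennreal_plus[symmetric] del: ennreal_plus)
    then show ?thesis using c by (simp add: field_simps power2_eq_square)
  qed
  then have "a \<le> b"
  proof -
    assume le: "\<And>c. 0 < c \<Longrightarrow> a - a\<^sup>2 / c \<le> b"
    have "((\<lambda>c. a - a\<^sup>2 / c) \<longlongrightarrow> a - 0) at_top"
      by (intro tendsto_diff tendsto_const tendsto_divide_0[OF tendsto_const] filterlim_ident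
          filterlim_at_top_imp_at_infinity)
    then show ?thesis
      by (intro tendsto_upperbound[of _ "a - 0" at_top, simplified])
        (auto intro!: eventually_mono[OF eventually_gt_at_top[of 0]] le)
  qed
  then show ?thesis unfolding a b by (rule ennreal_leI)
qed

corollary nn_integral_Max_shift:
  assumes "stationary_field M (max_stable_field V Zc)" "finite J" "J \<noteq> {}"
    and "\<And>t. integrable M (Z t)"
  shows "(\<integral>\<^sup>+\<omega>. ennreal (Max ((\<lambda>t. Z (t + h) \<omega>) ` J)) \<partial>M) =
    (\<integral>\<^sup>+\<omega>. ennreal (Max ((\<lambda>t. Z t \<omega>) ` J)) \<partial>M)"
  using nn_integral_Max_le_shift[OF assms, of h 0] nn_integral_Max_le_shift[OF assms, of 0 h]
  by simp

end

section \<open>Bounded distributions are determined by their moments\<close>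

text \<open>The Taylor polynomials of the characteristic function at \<open>0\<close> depend on the moments only, and for
  a bounded distribution their remainders tend to \<open>0\<close> at every point.\<close>

lemma real_distribution_eqI_moments:
  fixes M N :: "real measure" and R :: real
  assumes M: "real_distribution M" and N: "real_distribution N"
    and bM: "AE x in M. \<bar>x\<bar> \<le> R" and bN: "AE x in N. \<bar>x\<bar> \<le> R"
    and eq: "\<And>k. (\<integral>x. x ^ k \<partial>M) = (\<integral>x. x ^ k \<partial>N)"
  shows "M = N"
proof -
  define c where
    "c t n = (\<Sum>k\<le>n. (\<i> * complex_of_real t) ^ k / fact k * complex_of_real (\<integral>x. x ^ k \<partial>N))"
    for t and n :: nat
  have char_lim: "c t \<longlonglongrightarrow> char L t"
    if "real_distribution L" and b: "AE x in L. \<bar>x\<bar> \<le> R"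
      and eq: "\<And>k. (\<integral>x. x ^ k \<partial>L) = (\<integral>x. x ^ k \<partial>N)" for L t
  proof -
    interpret L: real_distribution L by fact
    have int: "integrable L (\<lambda>x. \<bar>x\<bar> ^ k)" for k
      by (rule L.integrable_const_bound[where B = "R ^ k"])
        (use b in \<open>auto elim!: eventually_mono intro!: power_mono\<close>)
    have int': "integrable L (\<lambda>x. x ^ k)" for k
      by (rule Bochner_Integration.integrable_bound[OF int[of k]]) (auto simp: power_abs)
    have "0 \<le> R"
    proof (rule ccontr)
      assume "\<not> 0 \<le> R"
      then have neg: "\<not> \<bar>x\<bar> \<le> R" for x :: real by linarith
      have "AE x in L. False" using b by (simp add: neg)
      then show False using L.AE_False by simp
    qed
    have mom: "L.expectation (\<lambda>x. \<bar>x\<bar> ^ n) \<le> R ^ n" for n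
    proof -
      have "L.expectation (\<lambda>x. \<bar>x\<bar> ^ n) \<le> L.expectation (\<lambda>_. R ^ n)"
        by (intro integral_mono_AE int) (use b in \<open>auto elim!: eventually_mono intro!: power_mono\<close>)
      then show ?thesis using L.prob_space by simp
    qed
    have bound: "cmod (c t n - char L t) \<le> 2 * (inverse (fact n) * (\<bar>t\<bar> * R) ^ n)" for n
    proof -
      have "cmod (c t n - char L t) \<le> (2 * \<bar>t\<bar> ^ n / fact n) * L.expectation (\<lambda>x. \<bar>x\<bar> ^ n)"
        unfolding c_def eq[symmetric] using L.char_approx1[of n t] int'
        by (simp add: norm_minus_commute)
      also have "\<dots> \<le> (2 * \<bar>t\<bar> ^ n / fact n) * R ^ n"
        by (intro mult_left_mono mom) auto
      finally show ?thesis
        by (simp add: field_simps)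
    qed
    have "(\<lambda>n. 2 * (inverse (fact n) * (\<bar>t\<bar> * R) ^ n)) \<longlonglongrightarrow> 2 * 0"
      by (intro tendsto_mult_left summable_LIMSEQ_zero summable_exp)
    then have "(\<lambda>n. c t n - char L t) \<longlonglongrightarrow> 0"
      by (intro Lim_null_comparison[OF always_eventually[OF allI[OF bound]]]) simp
    then show ?thesis by (simp add: LIM_zero_iff)
  qed
  have "char M t = char N t" for t
    using LIMSEQ_unique[OF char_lim[OF M bM eq] char_lim[OF N bN refl]] .
  then show ?thesis
    by (intro Levy_uniqueness M N) auto
qed

section \<open>Stationary random open sets\<close>

locale random_open_set = sigma_finite_measure P for P :: "'p measure" +
  fixes A :: "'p \<Rightarrow> (real^'n) set"
  assumes open_A: "open (A p)"
    and pred_A: "Measurable.pred (P \<Otimes>\<^sub>M borel) (\<lambda>x. snd x \<in> A (fst x))"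
begin

lemma measurable_mem_A [measurable (raw)]:
  assumes "f \<in> measurable N P" "g \<in> borel_measurable N"
  shows "Measurable.pred N (\<lambda>x. g x \<in> A (f x))"
proof -
  have "(\<lambda>x. (f x, g x)) \<in> measurable N (P \<Otimes>\<^sub>M borel)"
    using assms by measurable
  from measurable_compose[OF this pred_A] show ?thesis by simp
qed

lemma borel_A [measurable]: "A p \<in> sets borel"
  using open_A by simp

lemma measurable_indicator_A [measurable (raw)]:
  assumes [measurable]: "f \<in> measurable N P" "g \<in> borel_measurable N"
  shows "(\<lambda>x. indicator (A (f x)) (g x) :: ennreal) \<in> borel_measurable N"
proof -
  have "(\<lambda>x. indicator {x\<in>space N. g x \<in> A (f x)} x :: ennreal) \<in> borel_measurable N"
    by measurable
  then show ?thesis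
    by (rule measurable_cong[THEN iffD1, rotated]) (auto simp: indicator_def)
qed

text \<open>The volume of \<open>(A - h) \<inter> C\<close>; the set is moved rather than the window, so that statements about
  different \<open>h\<close> share the same \<open>C\<close>.\<close>

definition vol :: "real^'n \<Rightarrow> (real^'n) set \<Rightarrow> 'p \<Rightarrow> ennreal" where
  "vol h C p = (\<integral>\<^sup>+u. indicator C u * indicator (A p) (h + u) \<partial>lborel)"

lemma measurable_vol [measurable]:
  assumes [measurable]: "C \<in> sets borel"
  shows "vol h C \<in> borel_measurable P"
  unfolding vol_def[abs_def] by measurable

lemma vol_le:
  assumes "C \<in> sets borel"
  shows "vol h C p \<le> emeasure lborel C"
proof -
  have "vol h C p \<le> (\<integral>\<^sup>+u. indicator C u \<partial>lborel)"
    unfolding vol_def by (intro nn_integral_mono) (auto split: split_indicator)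
  then show ?thesis using assms by simp
qed

end

text \<open>The measure may be infinite, so the void event has no useful measure; stationarity is expressed
  through the hitting events of finite nonempty sets, which have finite measure.\<close>

locale stationary_random_open_set = random_open_set P A
  for P :: "'p measure" and A :: "'p \<Rightarrow> (real^'n) set" +
  assumes emeasure_origin: "emeasure P {p\<in>space P. 0 \<in> A p} = 1"
    and emeasure_hit_shift:
      "finite K \<Longrightarrow> K \<noteq> {} \<Longrightarrow> emeasure P {p\<in>space P. \<exists>t\<in>K. h + t \<in> A p} = emeasure P {p\<in>space P. \<exists>t\<in>K. t \<in> A p}"
begin

lemma emeasure_point: "emeasure P {p\<in>space P. h \<in> A p} = 1"
  using emeasure_hit_shift[of "{0}" h] emeasure_origin by simp

lemma emeasure_hit_finite:
  assumes "finite K"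
  shows "emeasure P {p\<in>space P. \<exists>t\<in>K. h + t \<in> A p} < \<infinity>"
proof -
  have "emeasure P {p\<in>space P. \<exists>t\<in>K. h + t \<in> A p} = emeasure P (\<Union>t\<in>K. {p\<in>space P. h + t \<in> A p})"
    by (intro arg_cong[where f = "emeasure P"]) auto
  also have "\<dots> \<le> (\<Sum>t\<in>K. emeasure P {p\<in>space P. h + t \<in> A p})"
    using assms by (intro emeasure_subadditive_finite) auto
  also have "\<dots> < \<infinity>"
    using assms by (simp add: emeasure_point of_nat_less_top)
  finally show ?thesis .
qed

text \<open>Induction on \<open>J\<close>: the condition \<open>j \<in> A\<close> is the difference of no condition at \<open>j\<close> and of
  \<open>j \<notin> A\<close>. The set \<open>K\<close> has to vary, and \<open>J\<close> has to stay nonempty to keep the measures finite.\<close>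

lemma emeasure_contains_avoids_shift:
  assumes "finite J" "J \<noteq> {}" "finite K"
  shows "emeasure P {p\<in>space P. (\<forall>t\<in>J. h + t \<in> A p) \<and> (\<forall>t\<in>K. h + t \<notin> A p)} =
         emeasure P {p\<in>space P. (\<forall>t\<in>J. t \<in> A p) \<and> (\<forall>t\<in>K. t \<notin> A p)}"
  using assms
proof (induction J arbitrary: K rule: finite_ne_induct)
  case (singleton j)
  have *: "emeasure P {p\<in>space P. (\<forall>t\<in>{j}. h + t \<in> A p) \<and> (\<forall>t\<in>K. h + t \<notin> A p)} =
        emeasure P {p\<in>space P. \<exists>t\<in>insert j K. h + t \<in> A p} -
        emeasure P {p\<in>space P. \<exists>t\<in>K. h + t \<in> A p}" for h
    using singleton emeasure_hit_finite[of K h]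
    by (subst emeasure_Diff[symmetric]) (auto intro!: arg_cong[where f = "emeasure P"])
  show ?case
    using *[of h] *[of 0] emeasure_hit_shift[of "insert j K" h] emeasure_hit_shift[of K h] singleton
    by (cases "K = {}") auto
next
  case (insert j J)
  have *: "emeasure P {p\<in>space P. (\<forall>t\<in>insert j J. h + t \<in> A p) \<and> (\<forall>t\<in>K. h + t \<notin> A p)} =
        emeasure P {p\<in>space P. (\<forall>t\<in>J. h + t \<in> A p) \<and> (\<forall>t\<in>K. h + t \<notin> A p)} -
        emeasure P {p\<in>space P. (\<forall>t\<in>J. h + t \<in> A p) \<and> (\<forall>t\<in>insert j K. h + t \<notin> A p)}" for h
  proof -
    have "emeasure P {p\<in>space P. (\<forall>t\<in>J. h + t \<in> A p) \<and> (\<forall>t\<in>insert j K. h + t \<notin> A p)} \<le>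
       emeasure P {p\<in>space P. \<exists>t\<in>J. h + t \<in> A p}"
      using insert by (intro emeasure_mono) auto
    also have "\<dots> < \<infinity>"
      using insert by (intro emeasure_hit_finite)
    finally show ?thesis
      using insert
      by (subst emeasure_Diff[symmetric]) (auto intro!: arg_cong[where f = "emeasure P"])
  qed
  show ?case
    using *[of h] *[of 0] insert.IH[of K] insert.IH[of "insert j K"] insert.prems by simp
qed

text \<open>One factor of the volume is an integral over points \<open>u\<close> of \<open>C\<close>; exchanging integrals moves \<open>u\<close>
  into \<open>J\<close> and lowers the exponent.\<close>

lemma moment_shift:
  assumes "finite J" "J \<noteq> {}" and [measurable]: "C \<in> sets borel"
  shows "(\<integral>\<^sup>+p. indicator {p. \<forall>t\<in>J. h + t \<in> A p} p * vol h C p ^ k \<partial>P) =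
         (\<integral>\<^sup>+p. indicator {p. \<forall>t\<in>J. t \<in> A p} p * vol 0 C p ^ k \<partial>P)"
  using assms(1,2)
proof (induction k arbitrary: J)
  case 0
  have *: "(\<integral>\<^sup>+p. indicator {p. \<forall>t\<in>J. h + t \<in> A p} p \<partial>P) =
        emeasure P {p\<in>space P. (\<forall>t\<in>J. h + t \<in> A p) \<and> (\<forall>t\<in>{}. h + t \<notin> A p)}" for h
  proof -
    have "{p\<in>space P. \<forall>t\<in>J. h + t \<in> A p} \<in> sets P"
      using 0 countable_finite[of J] by measurable
    then have "emeasure P {p\<in>space P. \<forall>t\<in>J. h + t \<in> A p} =
        (\<integral>\<^sup>+p. indicator {p\<in>space P. \<forall>t\<in>J. h + t \<in> A p} p \<partial>P)" by simp
    also have "\<dots> = (\<integral>\<^sup>+p. indicator {p. \<forall>t\<in>J. h + t \<in> A p} p \<partial>P)"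
      by (intro nn_integral_cong) (auto split: split_indicator)
    finally show ?thesis by simp
  qed
  show ?case
    using *[of h] *[of 0] emeasure_contains_avoids_shift[of J "{}" h] 0 by simp
next
  case (Suc k)
  interpret pair: pair_sigma_finite lborel P ..
  have [measurable]: "finite J" "countable J"
    using Suc by (auto intro: countable_finite)
  have *: "(\<integral>\<^sup>+p. indicator {p. \<forall>t\<in>J. h + t \<in> A p} p * vol h C p ^ Suc k \<partial>P) =
    (\<integral>\<^sup>+u. indicator C u * (\<integral>\<^sup>+p. indicator {p. \<forall>t\<in>insert u J. h + t \<in> A p} p * vol h C p ^ k \<partial>P) \<partial>lborel)"
    (is "?L = ?R") for h
  proof -
    have "?L = (\<integral>\<^sup>+p. (\<integral>\<^sup>+u. indicator {p. \<forall>t\<in>J. h + t \<in> A p} p * vol h C p ^ k *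
        (indicator C u * indicator (A p) (h + u)) \<partial>lborel) \<partial>P)"
      by (subst nn_integral_cmult) (auto intro!: nn_integral_cong simp: vol_def mult_ac)
    also have "\<dots> = (\<integral>\<^sup>+u. (\<integral>\<^sup>+p. indicator {p. \<forall>t\<in>J. h + t \<in> A p} p * vol h C p ^ k *
        (indicator C u * indicator (A p) (h + u)) \<partial>P) \<partial>lborel)"
      by (intro pair.Fubini') (auto simp: split_beta')
    also have "\<dots> = (\<integral>\<^sup>+u. (\<integral>\<^sup>+p. indicator C u * (indicator {p. \<forall>t\<in>insert u J. h + t \<in> A p} p *
        vol h C p ^ k) \<partial>P) \<partial>lborel)"
      by (intro nn_integral_cong) (auto simp: indicator_def)
    also have "\<dots> = ?R"
    proof (intro nn_integral_cong nn_integral_cmult)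
      fix u :: "real^'n"
      have [measurable]: "countable (insert u J)" using \<open>countable J\<close> by (rule countable_insert)
      show "(\<lambda>p. indicator {p. \<forall>t\<in>insert u J. h + t \<in> A p} p * vol h C p ^ k)
          \<in> borel_measurable P"
        by measurable
    qed
    finally show ?thesis .
  qed
  show ?case
    using *[of h] *[of 0] Suc.IH[of "insert _ J"] Suc.prems by simp
qed

text \<open>The density \<open>1\<^sub>A(h)\<close> turns \<open>P\<close> into a probability measure, the Palm distribution at \<open>h\<close>. The
  moments of the bounded volume, and hence its law, are the same for all \<open>h\<close>.\<close>

lemma vol_shift_eq_law:
  assumes [measurable]: "C \<in> sets borel" and fin: "emeasure lborel C < \<infinity>"
    and g [measurable]: "g \<in> borel_measurable borel"
  shows "(\<integral>\<^sup>+p. indicator (A p) h * g (vol h C p) \<partial>P) = (\<integral>\<^sup>+p. indicator (A p) 0 * g (vol 0 C p) \<partial>P)"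
proof -
  define R where "R = enn2real (emeasure lborel C)"
  define Q where "Q h = density P (\<lambda>p. indicator (A p) h)" for h
  define L where "L h = distr (Q h) borel (\<lambda>p. enn2real (vol h C p))" for h
  have sets_Q [measurable_cong]: "sets (Q h) = sets P" for h
    by (simp add: Q_def)
  have R: "emeasure lborel C = ennreal R"
    using fin by (simp add: R_def)
  have vol_R: "vol h C p \<le> ennreal R" for h p
    using vol_le[of C h p] R by simp
  have vol_eq: "ennreal (enn2real (vol h C p)) = vol h C p" for h p
    using vol_R[of h p] by (intro ennreal_enn2real) (auto simp: top_unique intro: le_less_trans)
  have prob_Q: "prob_space (Q h)" for h
  proof
    have "emeasure (Q h) (space (Q h)) = (\<integral>\<^sup>+p. indicator (A p) h * indicator (space P) p \<partial>P)"
      unfolding Q_def by (subst emeasure_density) auto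
    also have "\<dots> = (\<integral>\<^sup>+p. indicator {p\<in>space P. h \<in> A p} p \<partial>P)"
      by (intro nn_integral_cong) (auto split: split_indicator)
    finally show "emeasure (Q h) (space (Q h)) = 1"
      by (simp add: emeasure_point)
  qed
  have dist: "real_distribution (L h)" for h
    unfolding L_def by (intro prob_space.real_distribution_distr prob_Q) measurable
  have nn_L: "(\<integral>\<^sup>+x. f x \<partial>L h) = (\<integral>\<^sup>+p. indicator (A p) h * f (enn2real (vol h C p)) \<partial>P)"
    if [measurable]: "f \<in> borel_measurable borel" for f h
    unfolding L_def Q_def by (subst nn_integral_distr) (auto simp: nn_integral_density)
  have bound: "AE x in L h. \<bar>x\<bar> \<le> R" for h
    unfolding L_def using vol_R[of h]
    by (subst AE_distr_iff) (auto intro!: AE_I2 enn2real_leI simp: R_def)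
  have mom: "(\<integral>x. x ^ k \<partial>L h) = (\<integral>x. x ^ k \<partial>L 0)" for k
  proof -
    have *: "(\<integral>x. x ^ k \<partial>L h) =
        enn2real (\<integral>\<^sup>+p. indicator {p. \<forall>t\<in>{0}. h + t \<in> A p} p * vol h C p ^ k \<partial>P)" for h
    proof -
      have "(\<integral>x. x ^ k \<partial>L h) = enn2real (\<integral>\<^sup>+x. ennreal (x ^ k) \<partial>L h)"
        unfolding L_def by (rule integral_eq_nn_integral) (auto simp: AE_distr_iff)
      also have "(\<integral>\<^sup>+x. ennreal (x ^ k) \<partial>L h) =
          (\<integral>\<^sup>+p. indicator {p. \<forall>t\<in>{0}. h + t \<in> A p} p * vol h C p ^ k \<partial>P)"
        by (subst nn_L)
          (auto intro!: nn_integral_cong simp: ennreal_power[symmetric] vol_eq split: split_indicator)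
      finally show ?thesis .
    qed
    show ?thesis
      using *[of h] *[of 0] moment_shift[of "{0}" C h k] by simp
  qed
  have "L h = L 0"
    by (rule real_distribution_eqI_moments[OF dist dist bound bound mom])
  moreover have "(\<integral>\<^sup>+p. indicator (A p) h * g (vol h C p) \<partial>P) = (\<integral>\<^sup>+x. g (ennreal x) \<partial>L h)" for h
    by (subst nn_L) (auto simp: vol_eq)
  ultimately show ?thesis
    by simp
qed

text \<open>The factor in front of \<open>g\<close> is an integral over the points \<open>t\<close> of \<open>A \<inter> C\<close>, and seen from such
  a \<open>t\<close> the window is \<open>C - t\<close>.\<close>

lemma mass_transport:
  assumes [measurable]: "C \<in> sets borel" and fin: "emeasure lborel C < \<infinity>"
    and g [measurable]: "g \<in> borel_measurable borel"
  shows "(\<integral>\<^sup>+p. vol 0 C p * g (vol 0 C p) \<partial>P) =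
    (\<integral>\<^sup>+t. indicator C t * (\<integral>\<^sup>+p. indicator (A p) 0 * g (vol 0 {u. t + u \<in> C} p) \<partial>P) \<partial>lborel)"
proof -
  interpret pair: pair_sigma_finite lborel P ..
  have vol_translate: "vol t {u. t + u \<in> C} p = vol 0 C p" for t p
  proof -
    have "vol 0 C p = (\<integral>\<^sup>+u. indicator C u * indicator (A p) u \<partial>distr lborel borel ((+) t))"
      unfolding lborel_distr_plus by (simp add: vol_def)
    also have "\<dots> = vol t {u. t + u \<in> C} p"
      unfolding vol_def
      by (subst nn_integral_distr) (auto intro!: nn_integral_cong split: split_indicator)
    finally show ?thesis ..
  qed
  have fin': "emeasure lborel {u. t + u \<in> C} < \<infinity>" for t
  proof -
    have "emeasure lborel C = emeasure (distr lborel borel ((+) t)) C"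
      by (subst lborel_distr_plus) simp
    also have "\<dots> = emeasure lborel {u. t + u \<in> C}"
      by (subst emeasure_distr) (auto intro!: arg_cong[where f = "emeasure lborel"])
    finally show ?thesis using fin by simp
  qed
  have "(\<integral>\<^sup>+p. vol 0 C p * g (vol 0 C p) \<partial>P) =
      (\<integral>\<^sup>+p. (\<integral>\<^sup>+t. indicator C t * (indicator (A p) t * g (vol 0 C p)) \<partial>lborel) \<partial>P)"
    unfolding mult.assoc[symmetric]
    by (subst nn_integral_multc) (auto simp: vol_def intro!: nn_integral_cong)
  also have "\<dots> = (\<integral>\<^sup>+t. (\<integral>\<^sup>+p. indicator C t * (indicator (A p) t * g (vol 0 C p)) \<partial>P) \<partial>lborel)"
    by (intro pair.Fubini') (auto simp: split_beta')
  also have "\<dots> = (\<integral>\<^sup>+t. indicator C t * (\<integral>\<^sup>+p. indicator (A p) t * g (vol 0 C p) \<partial>P) \<partial>lborel)"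
    by (intro nn_integral_cong nn_integral_cmult) measurable
  also have "\<dots> = (\<integral>\<^sup>+t. indicator C t *
      (\<integral>\<^sup>+p. indicator (A p) 0 * g (vol 0 {u. t + u \<in> C} p) \<partial>P) \<partial>lborel)"
  proof (rule nn_integral_cong, rule arg_cong2[where f = "(*)", OF refl])
    fix t :: "real^'n"
    have "(\<integral>\<^sup>+p. indicator (A p) t * g (vol 0 C p) \<partial>P) =
        (\<integral>\<^sup>+p. indicator (A p) t * g (vol t {u. t + u \<in> C} p) \<partial>P)"
      by (simp only: vol_translate)
    also have "\<dots> = (\<integral>\<^sup>+p. indicator (A p) 0 * g (vol 0 {u. t + u \<in> C} p) \<partial>P)"
      by (intro vol_shift_eq_law fin' g) measurable
    finally show "(\<integral>\<^sup>+p. indicator (A p) t * g (vol 0 C p) \<partial>P) =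
        (\<integral>\<^sup>+p. indicator (A p) 0 * g (vol 0 {u. t + u \<in> C} p) \<partial>P)" .
  qed
  finally show ?thesis .
qed

end

section \<open>Volumes in large cubes\<close>

lemma tendsto_inverse_ennreal:
  fixes f :: "'a \<Rightarrow> ennreal"
  assumes "(f \<longlongrightarrow> l) F" "l \<noteq> 0"
  shows "((\<lambda>x. inverse (f x)) \<longlongrightarrow> inverse l) F"
proof -
  have "((\<lambda>x. 1 / enn2ereal (f x)) \<longlongrightarrow> 1 / enn2ereal l) F"
    using assms by (intro tendsto_inverse_ereal) (auto simp: tendsto_enn2ereal_iff zero_ennreal.rep_eq[symmetric] enn2ereal_inject)
  then show ?thesis
    by (simp add: tendsto_enn2ereal_iff[symmetric] inverse_ennreal.rep_eq divide_ereal_def)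
qed

lemma ennreal_inverse_antimono:
  fixes a b :: ennreal
  assumes "a \<le> b"
  shows "inverse b \<le> inverse a"
  using assms unfolding less_eq_ennreal.rep_eq inverse_ennreal.rep_eq
  by (intro ereal_inverse_antimono enn2ereal_nonneg)

text \<open>The closed cube becomes an open one: only for interior points \<open>v\<close> do the windows around the
  origin defined below grow in all directions.\<close>

lemma nn_integral_cube_scale:
  fixes f :: "real^'n \<Rightarrow> ennreal"
  assumes [measurable]: "f \<in> borel_measurable borel" and "0 < T"
  shows "(\<integral>\<^sup>+t. indicator (cbox 0 (vec T)) t * f t \<partial>lborel) =
    ennreal (T ^ CARD('n)) * (\<integral>\<^sup>+v. indicator (box 0 (vec 1)) v * f (T *\<^sub>R v) \<partial>lborel)"
proof -
  have "(\<integral>\<^sup>+t. indicator (cbox 0 (vec T)) t * f t \<partial>lborel) =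
      (\<integral>\<^sup>+t. indicator (cbox 0 (vec T)) t * f t
        \<partial>density (distr lborel borel (\<lambda>v. 0 + T *\<^sub>R v)) (\<lambda>_. \<bar>T\<bar> ^ DIM(real^'n)))"
    using \<open>0 < T\<close> by (subst lborel_affine[of T 0]) auto
  also have "\<dots> = (\<integral>\<^sup>+v. ennreal (T ^ CARD('n)) *
      (indicator (cbox 0 (vec T)) (T *\<^sub>R v) * f (T *\<^sub>R v)) \<partial>lborel)"
    using \<open>0 < T\<close> by (subst nn_integral_density) (auto simp: nn_integral_distr)
  also have "\<dots> = ennreal (T ^ CARD('n)) *
      (\<integral>\<^sup>+v. indicator (cbox 0 (vec T)) (T *\<^sub>R v) * f (T *\<^sub>R v) \<partial>lborel)"
    by (rule nn_integral_cmult) measurable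
  also have "(\<integral>\<^sup>+v. indicator (cbox 0 (vec T)) (T *\<^sub>R v) * f (T *\<^sub>R v) \<partial>lborel) =
      (\<integral>\<^sup>+v. indicator (box 0 (vec 1)) v * f (T *\<^sub>R v) \<partial>lborel)"
  proof (rule nn_integral_cong_AE)
    have cube: "T *\<^sub>R v \<in> cbox 0 (vec T) \<longleftrightarrow> v \<in> cbox 0 (vec 1)" for v :: "real^'n"
      using \<open>0 < T\<close> by (auto simp: mem_box_cart mult_le_cancel_left1 mult_le_cancel_left2 zero_le_mult_iff)
    show "AE v in lborel. indicator (cbox 0 (vec T)) (T *\<^sub>R v) * f (T *\<^sub>R v) =
        indicator (box 0 (vec 1)) v * f (T *\<^sub>R v)"
      using AE_not_in[OF null_sets_cbox_Diff_box[of 0 "vec 1 :: real^'n"]]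
    proof eventually_elim
      case (elim v)
      then have "v \<in> cbox 0 (vec 1) \<longleftrightarrow> v \<in> box 0 (vec 1)"
        using box_subset_cbox[of 0 "vec 1"] by blast
      then show ?case by (simp add: indicator_def cube)
    qed
  qed
  finally show ?thesis .
qed

text \<open>In \<open>ennreal\<close> this is \<open>0\<close> at infinite volume, as it should be: an infinite cluster contributes
  nothing to the limit.\<close>

definition reciprocal_above :: "real \<Rightarrow> ennreal \<Rightarrow> ennreal" where
  "reciprocal_above x v = (if ennreal x < v then inverse v else 0)"

lemma measurable_reciprocal_above [measurable]:
  "reciprocal_above x \<in> borel_measurable borel"
  unfolding reciprocal_above_def[abs_def] by measurable

lemma mult_reciprocal_above:
  "v < \<top> \<Longrightarrow> v * reciprocal_above x v = indicator {v. ennreal x < v} v"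
  using mult_divide_eq_ennreal[of v 1]
  by (auto simp: reciprocal_above_def divide_ennreal_def dest: gr_implies_not_zero)

lemma reciprocal_above_le:
  "0 < w \<Longrightarrow> w \<le> v \<Longrightarrow> reciprocal_above x v \<le> reciprocal_above 0 w"
  by (auto simp: reciprocal_above_def intro!: ennreal_inverse_antimono)

text \<open>Only left continuity is available at \<open>v = x\<close>, whence the bound by the limit.\<close>

lemma tendsto_reciprocal_above_mono:
  assumes "(f \<longlongrightarrow> v) F" and le: "\<And>T. f T \<le> v"
  shows "((\<lambda>T. reciprocal_above x (f T)) \<longlongrightarrow> reciprocal_above x v) F"
proof (cases "ennreal x < v")
  case True
  then have "v \<noteq> 0" by auto
  have "\<forall>\<^sub>F T in F. inverse (f T) = reciprocal_above x (f T)"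
    using order_tendstoD(1)[OF assms(1) True] by eventually_elim (simp add: reciprocal_above_def)
  then show ?thesis
    using Lim_transform_eventually[OF tendsto_inverse_ennreal[OF assms(1) \<open>v \<noteq> 0\<close>]] True
    by (simp add: reciprocal_above_def)
next
  case False
  then have "\<not> ennreal x < f T" for T using le[of T] by auto
  with False show ?thesis by (simp add: reciprocal_above_def)
qed

lemma tendsto_reciprocal_above_level:
  assumes "(f \<longlongrightarrow> x) F" and "ennreal x \<noteq> v"
  shows "((\<lambda>T. reciprocal_above (f T) v) \<longlongrightarrow> reciprocal_above x v) F"
proof -
  have lim: "((\<lambda>T. ennreal (f T)) \<longlongrightarrow> ennreal x) F"
    using assms(1) by (rule tendsto_ennrealI)
  consider "ennreal x < v" | "v < ennreal x" using assms(2) by fastforce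
  then have "\<forall>\<^sub>F T in F. reciprocal_above (f T) v = reciprocal_above x v"
  proof cases
    case 1
    show ?thesis
      using order_tendstoD(2)[OF lim 1] by eventually_elim (use 1 in \<open>simp add: reciprocal_above_def\<close>)
  next
    case 2
    show ?thesis
      using order_tendstoD(1)[OF lim 2] by eventually_elim (use 2 in \<open>auto simp: reciprocal_above_def\<close>)
  qed
  then show ?thesis by (rule tendsto_eventually)
qed

context random_open_set
begin

lemma vol_eq_emeasure:
  assumes "C \<in> sets borel"
  shows "vol 0 C p = emeasure lborel (C \<inter> A p)"
proof -
  have "vol 0 C p = (\<integral>\<^sup>+u. indicator (C \<inter> A p) u \<partial>lborel)"
    unfolding vol_def by (intro nn_integral_cong) (auto split: split_indicator)
  then show ?thesis using assms by simp
qed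

lemma vol_mono: "C \<subseteq> D \<Longrightarrow> vol 0 C p \<le> vol 0 D p"
  unfolding vol_def by (intro nn_integral_mono) (auto split: split_indicator)

lemma vol_pos:
  assumes "0 \<in> A p" "C \<in> sets borel" "open U" "0 \<in> U" "U \<subseteq> C"
  shows "0 < vol 0 C p"
proof -
  have "\<not> negligible (U \<inter> A p)"
    using assms open_A[of p] by (intro open_not_negligible) auto
  then have "emeasure lborel (U \<inter> A p) \<noteq> 0"
    using assms open_A[of p] by (auto simp: negligible_iff_null_sets null_sets_completion_iff null_sets_def)
  then have "0 < vol 0 U p"
    using assms by (simp add: vol_eq_emeasure zero_less_iff_neq_zero)
  also have "\<dots> \<le> vol 0 C p" using assms by (intro vol_mono)
  finally show ?thesis .
qed

text \<open>The expectation of \<open>1 / vol A\<close> under the Palm distribution at the origin on the event that the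
  volume exceeds \<open>x\<close>. It will turn out to be the Berman function.\<close>

definition palm_tail :: "real \<Rightarrow> ennreal" where
  "palm_tail x = (\<integral>\<^sup>+p. indicator (A p) 0 * reciprocal_above x (vol 0 UNIV p) \<partial>P)"

end

text \<open>The cube of side \<open>T\<close> seen from its point \<open>T v\<close>.\<close>

definition window :: "real \<Rightarrow> real^'n \<Rightarrow> (real^'n) set" where
  "window T v = {u. T *\<^sub>R v + u \<in> cbox 0 (vec T)}"

lemma window_borel [measurable]: "window T v \<in> sets borel"
  unfolding window_def by measurable

lemma mem_window: "u \<in> window T v \<longleftrightarrow> (\<forall>i. - (T * v $ i) \<le> u $ i \<and> u $ i \<le> T * (1 - v $ i))"
  by (simp add: window_def mem_box_cart algebra_simps) (smt (verit))

lemma window_mono: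
  assumes "v \<in> box 0 (vec 1)" "T \<le> T'"
  shows "window T v \<subseteq> window T' v"
proof
  fix u assume u: "u \<in> window T v"
  have "T * v $ i \<le> T' * v $ i" "T * (1 - v $ i) \<le> T' * (1 - v $ i)" for i
    using assms by (auto simp: mem_box_cart intro!: mult_right_mono less_imp_le)
  with u show "u \<in> window T' v"
    unfolding mem_window by (meson order_trans neg_le_iff_le)
qed

lemma window_exhausts:
  assumes "v \<in> box 0 (vec 1 :: real^'n)"
  shows "(\<Union>n. window (real n) v) = UNIV"
proof -
  have "\<exists>n. u \<in> window (real n) v" for u
  proof -
    obtain N where N: "\<And>i. \<bar>u $ i\<bar> \<le> real (N i) * v $ i \<and> \<bar>u $ i\<bar> \<le> real (N i) * (1 - v $ i)"
    proof -
      have "\<exists>n. \<bar>u $ i\<bar> \<le> real n * v $ i \<and> \<bar>u $ i\<bar> \<le> real n * (1 - v $ i)" for i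
      proof -
        have pos: "0 < min (v $ i) (1 - v $ i)" using assms by (auto simp: mem_box_cart)
        then obtain n where "\<bar>u $ i\<bar> < real n * min (v $ i) (1 - v $ i)"
          using reals_Archimedean3 by blast
        moreover have "real n * min (v $ i) (1 - v $ i) \<le> real n * v $ i"
          "real n * min (v $ i) (1 - v $ i) \<le> real n * (1 - v $ i)"
          by (auto intro!: mult_left_mono)
        ultimately show ?thesis by (intro exI[of _ n]) linarith
      qed
      then show ?thesis using that by metis
    qed
    define n where "n = Max (range N)"
    have "u \<in> window (real n) v"
      unfolding mem_window
    proof
      fix i
      have "real (N i) \<le> real n" by (simp add: n_def)
      then have "real (N i) * v $ i \<le> real n * v $ i" "real (N i) * (1 - v $ i) \<le> real n * (1 - v $ i)"
        using assms by (intro mult_right_mono; simp add: mem_box_cart less_imp_le)+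
      with N[of i] show "- (real n * v $ i) \<le> u $ i \<and> u $ i \<le> real n * (1 - v $ i)" by linarith
    qed
    then show ?thesis by blast
  qed
  then show ?thesis by blast
qed

lemma window_contains_open:
  assumes "v \<in> box 0 (vec 1 :: real^'n)" "0 < T"
  shows "\<exists>U. open U \<and> 0 \<in> U \<and> U \<subseteq> window T v"
proof (intro exI conjI)
  show "open (box (- (T *\<^sub>R v)) (T *\<^sub>R (vec 1 - v)))" by (rule open_box)
  show "0 \<in> box (- (T *\<^sub>R v)) (T *\<^sub>R (vec 1 - v))" using assms by (simp add: mem_box_cart)
  show "box (- (T *\<^sub>R v)) (T *\<^sub>R (vec 1 - v)) \<subseteq> window T v"
    by (auto simp: mem_box_cart mem_window less_imp_le)
qed


context random_open_set begin

lemma tendsto_vol_window: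
  assumes v: "v \<in> box 0 (vec 1)"
  shows "((\<lambda>T. vol 0 (window T v) p) \<longlongrightarrow> vol 0 UNIV p) at_top"
proof (rule increasing_tendsto)
  show "\<forall>\<^sub>F T in at_top. vol 0 (window T v) p \<le> vol 0 UNIV p"
    by (intro always_eventually allI vol_mono) simp
next
  fix y assume "y < vol 0 UNIV p"
  also have "vol 0 UNIV p = (SUP n. vol 0 (window (real n) v) p)"
  proof -
    have "vol 0 UNIV p = emeasure lborel (\<Union>n. window (real n) v \<inter> A p)"
      using window_exhausts[OF v] by (simp add: vol_eq_emeasure Int_UN_distrib2[symmetric])
    also have "\<dots> = (SUP n. emeasure lborel (window (real n) v \<inter> A p))"
    proof (rule SUP_emeasure_incseq[symmetric])
      show "incseq (\<lambda>n. window (real n) v \<inter> A p)"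
        by (rule incseq_SucI) (intro Int_mono window_mono[OF v]; simp)
    qed auto
    finally show ?thesis by (simp add: vol_eq_emeasure)
  qed
  finally obtain n where n: "y < vol 0 (window (real n) v) p" by (auto simp: less_SUP_iff)
  show "\<forall>\<^sub>F T in at_top. y < vol 0 (window T v) p"
    using eventually_ge_at_top[of "real n"]
    by eventually_elim (rule less_le_trans[OF n vol_mono[OF window_mono[OF v]]])
qed

end

section \<open>Convergence of the normalised tails and continuity of their limit\<close>

locale locally_finite_stationary_random_open_set = stationary_random_open_set P A
  for P :: "'p measure" and A :: "'p \<Rightarrow> (real^'n) set" +
  assumes emeasure_meets_unit_cube: "emeasure P {p\<in>space P. 0 < vol 0 (cbox 0 (vec 1)) p} < \<infinity>"
begin

text \<open>The integrand of the mass transport identity for the cube of side \<open>T\<close>, as a function of both a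
  point \<open>v\<close> of the unit cube and the sample \<open>p\<close>, after the point \<open>T v\<close> has been moved to the origin.\<close>

definition cube_density :: "real \<Rightarrow> real \<Rightarrow> (real^'n) \<times> 'p \<Rightarrow> ennreal" where
  "cube_density x T z = indicator (box 0 (vec 1)) (fst z) * (indicator (A (snd z)) 0 *
     reciprocal_above x (vol 0 (window T (fst z)) (snd z)))"

lemma measurable_cube_density [measurable]: "cube_density x T \<in> borel_measurable (lborel \<Otimes>\<^sub>M P)"
  unfolding cube_density_def[abs_def] window_def vol_def by measurable

lemma emeasure_vol_cube:
  assumes "0 < T"
  shows "emeasure P {p\<in>space P. ennreal x < vol 0 (cbox 0 (vec T)) p} =
    ennreal (T ^ CARD('n)) * (\<integral>\<^sup>+z. cube_density x T z \<partial>(lborel \<Otimes>\<^sub>M P))"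
proof -
  let ?C = "cbox 0 (vec T) :: (real^'n) set"
  have fin: "emeasure lborel ?C < \<infinity>" by (rule emeasure_lborel_cbox_finite)
  have "vol 0 ?C p < \<top>" for p
    using le_less_trans[OF vol_le fin] by simp
  then have "(\<integral>\<^sup>+p. vol 0 ?C p * reciprocal_above x (vol 0 ?C p) \<partial>P) =
      (\<integral>\<^sup>+p. indicator {p\<in>space P. ennreal x < vol 0 ?C p} p \<partial>P)"
    by (intro nn_integral_cong) (auto simp: mult_reciprocal_above split: split_indicator)
  then have "emeasure P {p\<in>space P. ennreal x < vol 0 ?C p} =
      (\<integral>\<^sup>+p. vol 0 ?C p * reciprocal_above x (vol 0 ?C p) \<partial>P)" by simp
  also have "\<dots> = (\<integral>\<^sup>+t. indicator ?C t *
      (\<integral>\<^sup>+p. indicator (A p) 0 * reciprocal_above x (vol 0 {u. t + u \<in> ?C} p) \<partial>P) \<partial>lborel)"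
    by (rule mass_transport[OF _ fin]) auto
  also have "\<dots> = ennreal (T ^ CARD('n)) * (\<integral>\<^sup>+v. indicator (box 0 (vec 1)) v *
      (\<integral>\<^sup>+p. indicator (A p) 0 * reciprocal_above x (vol 0 (window T v) p) \<partial>P) \<partial>lborel)"
    unfolding window_def vol_def by (rule nn_integral_cube_scale[OF _ assms]) measurable
  also have "(\<integral>\<^sup>+v. indicator (box 0 (vec 1)) v *
      (\<integral>\<^sup>+p. indicator (A p) 0 * reciprocal_above x (vol 0 (window T v) p) \<partial>P) \<partial>lborel) =
      (\<integral>\<^sup>+v. (\<integral>\<^sup>+p. indicator (box 0 (vec 1)) v *
      (indicator (A p) 0 * reciprocal_above x (vol 0 (window T v) p)) \<partial>P) \<partial>lborel)"
    by (intro nn_integral_cong nn_integral_cmult[symmetric]) measurable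
  also have "\<dots> = (\<integral>\<^sup>+z. cube_density x T z \<partial>(lborel \<Otimes>\<^sub>M P))"
    by (subst nn_integral_fst[symmetric]) (simp_all add: cube_density_def)
  finally show ?thesis .
qed

lemma nn_integral_unit_cube_density_finite: "(\<integral>\<^sup>+z. cube_density 0 1 z \<partial>(lborel \<Otimes>\<^sub>M P)) < \<infinity>"
  using emeasure_vol_cube[of 1 0] emeasure_meets_unit_cube by simp

text \<open>The domination behind the limit in \<open>T\<close>: the windows grow with \<open>T\<close>, and for \<open>T = 1\<close> the volume is
  already positive because \<open>0\<close> is an interior point of both \<open>A\<close> and the window.\<close>

lemma cube_density_le: "1 \<le> T \<Longrightarrow> cube_density x T z \<le> cube_density 0 1 z"
  unfolding cube_density_def
proof (cases "fst z \<in> box 0 (vec 1) \<and> 0 \<in> A (snd z)", goal_cases)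
  case 1
  then obtain U where "open U" "0 \<in> U" "U \<subseteq> window 1 (fst z)"
    using window_contains_open[of "fst z" 1] by auto
  then have "0 < vol 0 (window 1 (fst z)) (snd z)"
    using 1 by (intro vol_pos[of _ _ U]) auto
  moreover have "window 1 (fst z) \<subseteq> window T (fst z)"
    using 1 by (intro window_mono) blast+
  ultimately have "reciprocal_above x (vol 0 (window T (fst z)) (snd z)) \<le>
      reciprocal_above 0 (vol 0 (window 1 (fst z)) (snd z))"
    by (intro reciprocal_above_le vol_mono)
  then show ?case
    by (intro mult_left_mono) auto
qed auto

lemma tendsto_nn_integral_cube_density:
  "((\<lambda>T. \<integral>\<^sup>+z. cube_density x T z \<partial>(lborel \<Otimes>\<^sub>M P)) \<longlongrightarrow> palm_tail x) at_top"
proof -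
  let ?I = "\<lambda>T. \<integral>\<^sup>+z. cube_density x T z \<partial>(lborel \<Otimes>\<^sub>M P)"
  let ?F = "\<lambda>z. indicator (box 0 (vec 1 :: real^'n)) (fst z) * (indicator (A (snd z)) 0 *
     reciprocal_above x (vol 0 UNIV (snd z)))"
  \<comment> \<open>The dominating function serves sides \<open>T \<ge> 1\<close> only, hence the truncation.\<close>
  have lim: "((\<lambda>T. ?I (max 1 T)) \<longlongrightarrow> (\<integral>\<^sup>+z. ?F z \<partial>(lborel \<Otimes>\<^sub>M P))) at_top"
  proof (rule tendsto_at_topI_sequentially)
    fix X :: "nat \<Rightarrow> real" assume X: "filterlim X at_top sequentially"
    have X1: "filterlim (\<lambda>n. max 1 (X n)) at_top sequentially"
      by (rule filterlim_at_top_mono[OF X]) simp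
    show "(\<lambda>n. ?I (max 1 (X n))) \<longlonglongrightarrow> (\<integral>\<^sup>+z. ?F z \<partial>(lborel \<Otimes>\<^sub>M P))"
    proof (rule nn_integral_dominated_convergence[where w = "cube_density 0 1"])
      show "AE z in lborel \<Otimes>\<^sub>M P. (\<lambda>n. cube_density x (max 1 (X n)) z) \<longlonglongrightarrow> ?F z"
      proof (rule AE_I2)
        fix z :: "(real^'n) \<times> 'p"
        show "(\<lambda>n. cube_density x (max 1 (X n)) z) \<longlonglongrightarrow> ?F z"
        proof (cases "fst z \<in> box 0 (vec 1)")
          case True
          have "(\<lambda>n. reciprocal_above x (vol 0 (window (max 1 (X n)) (fst z)) (snd z)))
              \<longlonglongrightarrow> reciprocal_above x (vol 0 UNIV (snd z))"
            by (rule tendsto_reciprocal_above_mono[OF filterlim_compose[OF tendsto_vol_window[OF True] X1]])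
              (simp add: vol_mono)
          with True show ?thesis
            by (cases "0 \<in> A (snd z)") (auto simp: cube_density_def)
        qed (simp add: cube_density_def)
      qed
    qed (use nn_integral_unit_cube_density_finite in \<open>auto intro!: AE_I2 cube_density_le\<close>)
  qed
  have "(\<integral>\<^sup>+z. ?F z \<partial>(lborel \<Otimes>\<^sub>M P)) = (\<integral>\<^sup>+v. indicator (box 0 (vec 1 :: real^'n)) v * palm_tail x \<partial>lborel)"
    unfolding palm_tail_def
    by (subst nn_integral_fst[symmetric]) (auto intro!: nn_integral_cong nn_integral_cmult)
  also have "\<dots> = palm_tail x"
  proof -
    have "(vec 1 :: real^'n) \<bullet> b = 1" if "b \<in> Basis" for b
      using that by (auto simp: Basis_vec_def inner_axis)
    then have "emeasure lborel (box 0 (vec 1 :: real^'n)) = 1"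
      by (subst emeasure_lborel_box) auto
    then show ?thesis by (simp add: nn_integral_multc)
  qed
  finally have "((\<lambda>T. ?I (max 1 T)) \<longlongrightarrow> palm_tail x) at_top"
    using lim by simp
  moreover have "\<forall>\<^sub>F T in at_top. ?I (max 1 T) = ?I T"
    using eventually_ge_at_top[of 1] by eventually_elim (simp add: max_def)
  ultimately show ?thesis
    by (rule Lim_transform_eventually)
qed

lemma palm_tail_finite: "palm_tail x < \<infinity>"
proof -
  have "palm_tail x \<le> (\<integral>\<^sup>+z. cube_density 0 1 z \<partial>(lborel \<Otimes>\<^sub>M P))"
    by (rule tendsto_upperbound[OF tendsto_nn_integral_cube_density])
      (auto intro!: eventually_mono[OF eventually_ge_at_top[of 1]] nn_integral_mono cube_density_le)
  then show ?thesis
    using nn_integral_unit_cube_density_finite by (rule le_less_trans)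
qed

theorem tendsto_cube_tail:
  "((\<lambda>T. 1 / T ^ CARD('n) * measure P {p\<in>space P. ennreal x < vol 0 (cbox 0 (vec T)) p})
     \<longlongrightarrow> enn2real (palm_tail x)) at_top"
proof -
  have "((\<lambda>T. enn2real (\<integral>\<^sup>+z. cube_density x T z \<partial>(lborel \<Otimes>\<^sub>M P))) \<longlongrightarrow> enn2real (palm_tail x)) at_top"
    using palm_tail_finite tendsto_nn_integral_cube_density by (intro tendsto_enn2real) auto
  moreover have "\<forall>\<^sub>F T in at_top. enn2real (\<integral>\<^sup>+z. cube_density x T z \<partial>(lborel \<Otimes>\<^sub>M P)) =
      1 / T ^ CARD('n) * measure P {p\<in>space P. ennreal x < vol 0 (cbox 0 (vec T)) p}"
    using eventually_gt_at_top[of 0]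
    by eventually_elim (simp add: measure_def emeasure_vol_cube enn2real_mult)
  ultimately show ?thesis
    by (rule Lim_transform_eventually)
qed

lemma emeasure_vol_cube_finite:
  assumes "1 \<le> T"
  shows "emeasure P {p\<in>space P. ennreal x < vol 0 (cbox 0 (vec T)) p} < \<infinity>"
proof -
  have "(\<integral>\<^sup>+z. cube_density x T z \<partial>(lborel \<Otimes>\<^sub>M P)) \<le> (\<integral>\<^sup>+z. cube_density 0 1 z \<partial>(lborel \<Otimes>\<^sub>M P))"
    using assms by (intro nn_integral_mono cube_density_le)
  also note nn_integral_unit_cube_density_finite
  finally show ?thesis
    using assms by (simp add: emeasure_vol_cube ennreal_mult_less_top)
qed

text \<open>Apart from the event that the volume equals \<open>x\<^sub>0\<close> the integrand is locally constant in the level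
  at \<open>x\<^sub>0\<close>, and it is dominated by its value at level \<open>0\<close>.\<close>

theorem palm_tail_continuous:
  assumes "0 \<le> x0"
    and null: "0 < x0 \<Longrightarrow> emeasure P {p\<in>space P. 0 \<in> A p \<and> vol 0 UNIV p = ennreal x0} = 0"
  shows "((\<lambda>x. enn2real (palm_tail x)) \<longlongrightarrow> enn2real (palm_tail x0)) (at x0 within {0..})"
proof -
  have pos: "0 < vol 0 UNIV p" if "0 \<in> A p" for p
    using that by (intro vol_pos[of _ _ UNIV]) auto
  have ne: "AE p in P. 0 \<in> A p \<longrightarrow> ennreal x0 \<noteq> vol 0 UNIV p"
  proof (cases "x0 = 0")
    case True
    then show ?thesis using pos by (intro AE_I2) (metis ennreal_0 less_irrefl)
  next
    case False
    then have "{p\<in>space P. 0 \<in> A p \<and> vol 0 UNIV p = ennreal x0} \<in> null_sets P"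
      using null assms(1) by (auto intro!: null_setsI)
    from AE_not_in[OF this] show ?thesis
      using AE_space by eventually_elim auto
  qed
  have "(palm_tail \<longlongrightarrow> palm_tail x0) (at x0 within {0..})"
    unfolding tendsto_at_iff_sequentially comp_def
  proof (intro allI impI)
    fix X :: "nat \<Rightarrow> real" assume X: "\<forall>i. X i \<in> {0..} - {x0}" "X \<longlonglongrightarrow> x0"
    show "(\<lambda>i. palm_tail (X i)) \<longlonglongrightarrow> palm_tail x0"
      unfolding palm_tail_def
    proof (rule nn_integral_dominated_convergence
        [where w = "\<lambda>p. indicator (A p) 0 * reciprocal_above 0 (vol 0 UNIV p)"])
      show "AE p in P. indicator (A p) 0 * reciprocal_above (X i) (vol 0 UNIV p) \<le>
          indicator (A p) 0 * reciprocal_above 0 (vol 0 UNIV p)" for i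
        by (intro AE_I2) (auto split: split_indicator intro!: reciprocal_above_le pos)
      show "(\<integral>\<^sup>+p. indicator (A p) 0 * reciprocal_above 0 (vol 0 UNIV p) \<partial>P) < \<infinity>"
        using palm_tail_finite[of 0] by (simp add: palm_tail_def)
      show "AE p in P. (\<lambda>i. indicator (A p) 0 * reciprocal_above (X i) (vol 0 UNIV p))
          \<longlonglongrightarrow> indicator (A p) 0 * reciprocal_above x0 (vol 0 UNIV p)"
        using ne
        by eventually_elim
          (use tendsto_reciprocal_above_level[OF X(2)] in \<open>auto split: split_indicator\<close>)
    qed auto
  qed
  then show ?thesis
    using palm_tail_finite[of x0] by (intro tendsto_enn2real) auto
qed

end

section \<open>Superlevel sets of a continuous random field\<close>

text \<open>A path whose superlevel set at \<open>s\<close> has finite volume takes some value at most \<open>s\<close>, and its value at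
  the origin is above \<open>s'\<close>. By the intermediate value theorem it also takes the value half-way
  between the two levels, so the open set where it lies strictly between them is nonempty.\<close>

lemma superlevel_volume_strict_mono:
  fixes g :: "real^'n \<Rightarrow> real"
  assumes cont: "continuous_on UNIV g" and "s < s'" "s' < g 0"
    and fin: "emeasure lborel {t. s < g t} < \<infinity>"
  shows "emeasure lborel {t. s' < g t} < emeasure lborel {t. s < g t}"
proof -
  let ?B = "{t. s < g t} \<inter> {t. g t < s'}"
  have open_gt: "open {t. c < g t}" for c
    using cont by (intro open_Collect_less) auto
  have "open {t. g t < s'}"
    using cont by (intro open_Collect_less) auto
  with open_gt have open_B: "open ?B" by (rule open_Int)
  have "emeasure lborel (UNIV :: (real^'n) set) = \<infinity>" by simp
  then have "{t. s < g t} \<noteq> UNIV" using fin by auto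
  then obtain t where "\<not> s < g t" by blast
  then have "g t \<le> (s + s') / 2" "(s + s') / 2 \<le> g 0" using assms(2,3) by simp_all
  then have "(s + s') / 2 \<in> range g"
    by (rule connectedD_interval[OF connected_continuous_image[OF cont connected_UNIV], of "g t" "g 0", rotated 2])
      (rule rangeI)+
  then obtain u where "g u = (s + s') / 2" by (metis imageE)
  then have "u \<in> ?B" using assms(2) by auto
  then have "\<not> negligible ?B"
    using open_B by (intro open_not_negligible) auto
  then have pos: "0 < emeasure lborel ?B"
    using open_B by (auto simp: negligible_iff_null_sets null_sets_completion_iff null_sets_def zero_less_iff_neq_zero)
  have le: "emeasure lborel {t. s' < g t} + emeasure lborel ?B \<le> emeasure lborel {t. s < g t}"
    using open_gt open_B assms(2) by (subst plus_emeasure) (auto intro!: emeasure_mono)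
  have "emeasure lborel {t. s' < g t} \<le> emeasure lborel {t. s < g t}"
    using open_gt assms(2) by (intro emeasure_mono) auto
  then have "emeasure lborel {t. s' < g t} < \<infinity>" using fin by (rule le_less_trans)
  then have "emeasure lborel {t. s' < g t} < emeasure lborel {t. s' < g t} + emeasure lborel ?B"
    using pos ennreal_add_left_cancel_less[of "emeasure lborel {t. s' < g t}" 0] by simp
  also note le
  finally show ?thesis .
qed

text \<open>Making the set empty at levels \<open>s \<le> 0\<close> allows all of \<open>lborel\<close> as the measure on levels.\<close>

definition superlevel :: "(real^'n \<Rightarrow> 'w \<Rightarrow> real) \<Rightarrow> 'w \<times> real \<Rightarrow> (real^'n) set" where
  "superlevel Y p = {t. 0 < snd p \<and> snd p < Y t (fst p)}"

locale continuous_field = prob_space M for M :: "'w measure" +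
  fixes Y :: "real^'n \<Rightarrow> 'w \<Rightarrow> real"
  assumes Y_measurable [measurable]: "Y t \<in> borel_measurable M"
    and Y_continuous: "continuous_on UNIV (\<lambda>t. Y t \<omega>)"
begin

text \<open>Joint measurability in point, outcome and level: continuity reduces the uncountably many points
  of a neighbourhood to those in a countable dense set. The strict gain \<open>1/(k+1)\<close> in the level
  survives the passage to the limit.\<close>

lemma less_Y_iff_dense_neighbourhood:
  assumes dense: "\<And>U. open U \<Longrightarrow> U \<noteq> {} \<Longrightarrow> \<exists>q\<in>D. q \<in> (U :: (real^'n) set)"
  shows "s < Y t \<omega> \<longleftrightarrow>
    (\<exists>k m. \<forall>q\<in>D. dist q t < 1 / real (Suc m) \<longrightarrow> s + 1 / real (Suc k) < Y q \<omega>)"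
proof
  assume "s < Y t \<omega>"
  then obtain k where k: "1 / real (Suc k) < Y t \<omega> - s"
    using nat_approx_posE[of "Y t \<omega> - s"] by auto
  have "open {u. s + 1 / real (Suc k) < Y u \<omega>}"
    using Y_continuous by (intro open_Collect_less) auto
  moreover have "t \<in> {u. s + 1 / real (Suc k) < Y u \<omega>}" using k by auto
  ultimately obtain e where e: "0 < e" "\<And>u. dist u t < e \<Longrightarrow> s + 1 / real (Suc k) < Y u \<omega>"
    by (auto simp: open_dist)
  obtain m where "1 / real (Suc m) < e" using nat_approx_posE[OF e(1)] by auto
  with e(2) show "\<exists>k m. \<forall>q\<in>D. dist q t < 1 / real (Suc m) \<longrightarrow> s + 1 / real (Suc k) < Y q \<omega>"
    by (intro exI[of _ k] exI[of _ m]) auto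
next
  assume "\<exists>k m. \<forall>q\<in>D. dist q t < 1 / real (Suc m) \<longrightarrow> s + 1 / real (Suc k) < Y q \<omega>"
  then obtain k m where km: "\<And>q. q \<in> D \<Longrightarrow> dist q t < 1 / real (Suc m) \<Longrightarrow> s + 1 / real (Suc k) < Y q \<omega>"
    by blast
  show "s < Y t \<omega>"
  proof (rule ccontr)
    assume "\<not> s < Y t \<omega>"
    then have "Y t \<omega> < s + 1 / real (Suc k)" by (smt (verit) divide_pos_pos of_nat_0_less_iff zero_less_Suc)
    then have t: "t \<in> {u. Y u \<omega> < s + 1 / real (Suc k)} \<inter> ball t (1 / real (Suc m))" by auto
    have "open ({u. Y u \<omega> < s + 1 / real (Suc k)} \<inter> ball t (1 / real (Suc m)))"
      using Y_continuous by (intro open_Int open_Collect_less) auto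
    then obtain q where "q \<in> D" "Y q \<omega> < s + 1 / real (Suc k)" "dist t q < 1 / real (Suc m)"
      using dense t by (metis (no_types, lifting) Int_iff empty_iff mem_Collect_eq mem_ball)
    with km[of q] show False by (simp add: dist_commute)
  qed
qed

lemma pred_mem_superlevel:
  "Measurable.pred ((M \<Otimes>\<^sub>M lborel) \<Otimes>\<^sub>M borel) (\<lambda>x. snd x \<in> superlevel Y (fst x))"
proof -
  obtain D :: "(real^'n) set" where [measurable]: "countable D"
    and dense: "\<And>U. open U \<Longrightarrow> U \<noteq> {} \<Longrightarrow> \<exists>q\<in>D. q \<in> U"
    using countable_dense_setE by blast
  have "(\<lambda>x. snd x \<in> superlevel Y (fst x)) = (\<lambda>x. 0 < snd (fst x) \<and> (\<exists>k m. \<forall>q\<in>D.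
      dist q (snd x) < 1 / real (Suc m) \<longrightarrow> snd (fst x) + 1 / real (Suc k) < Y q (fst (fst x))))"
  proof
    fix x :: "('w \<times> real) \<times> (real^'n)"
    note iff = less_Y_iff_dense_neighbourhood[OF dense, of "snd (fst x)" "snd x" "fst (fst x)"]
    show "(snd x \<in> superlevel Y (fst x)) = (0 < snd (fst x) \<and> (\<exists>k m. \<forall>q\<in>D.
      dist q (snd x) < 1 / real (Suc m) \<longrightarrow> snd (fst x) + 1 / real (Suc k) < Y q (fst (fst x))))"
      unfolding superlevel_def mem_Collect_eq by (subst iff) (assumption+, rule refl)
  qed
  moreover have "Measurable.pred ((M \<Otimes>\<^sub>M lborel) \<Otimes>\<^sub>M borel) (\<lambda>x. 0 < snd (fst x) \<and> (\<exists>k m. \<forall>q\<in>D.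
      dist q (snd x) < 1 / real (Suc m) \<longrightarrow> snd (fst x) + 1 / real (Suc k) < Y q (fst (fst x))))"
    by measurable
  ultimately show ?thesis by simp
qed

sublocale S: random_open_set "M \<Otimes>\<^sub>M lborel" "superlevel Y"
proof
  interpret pair_sigma_finite M lborel ..
  show "\<exists>A. countable A \<and> A \<subseteq> sets (M \<Otimes>\<^sub>M lborel) \<and> \<Union> A = space (M \<Otimes>\<^sub>M lborel) \<and>
      (\<forall>a\<in>A. emeasure (M \<Otimes>\<^sub>M lborel) a \<noteq> \<infinity>)"
    by (rule sigma_finite_countable)
  show "open (superlevel Y p)" for p
    unfolding superlevel_def using Y_continuous by (intro open_Collect_conj open_Collect_less) auto
  show "Measurable.pred ((M \<Otimes>\<^sub>M lborel) \<Otimes>\<^sub>M borel) (\<lambda>x. snd x \<in> superlevel Y (fst x))"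
    by (rule pred_mem_superlevel)
qed

lemma emeasure_superlevel_hits:
  assumes "finite K" "K \<noteq> {}"
  shows "emeasure (M \<Otimes>\<^sub>M lborel) {p\<in>space (M \<Otimes>\<^sub>M lborel). \<exists>t\<in>K. h + t \<in> superlevel Y p} =
    (\<integral>\<^sup>+\<omega>. ennreal (Max ((\<lambda>t. Y (t + h) \<omega>) ` K)) \<partial>M)"
proof -
  have [measurable]: "countable K" using assms by (intro countable_finite)
  have "emeasure (M \<Otimes>\<^sub>M lborel) {p\<in>space (M \<Otimes>\<^sub>M lborel). \<exists>t\<in>K. h + t \<in> superlevel Y p} =
    (\<integral>\<^sup>+\<omega>. emeasure lborel (Pair \<omega> -` {p\<in>space (M \<Otimes>\<^sub>M lborel). \<exists>t\<in>K. h + t \<in> superlevel Y p}) \<partial>M)"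
    by (rule lborel.emeasure_pair_measure_alt) measurable
  also have "\<dots> = (\<integral>\<^sup>+\<omega>. ennreal (Max ((\<lambda>t. Y (t + h) \<omega>) ` K)) \<partial>M)"
  proof (rule nn_integral_cong)
    fix \<omega> assume "\<omega> \<in> space M"
    let ?m = "Max ((\<lambda>t. Y (t + h) \<omega>) ` K)"
    have "s < ?m \<longleftrightarrow> (\<exists>t\<in>K. s < Y (h + t) \<omega>)" for s
      using assms by (subst Max_gr_iff) (auto simp: add.commute)
    then have eq: "Pair \<omega> -` {p\<in>space (M \<Otimes>\<^sub>M lborel). \<exists>t\<in>K. h + t \<in> superlevel Y p} = {0<..<?m}"
      using \<open>\<omega> \<in> space M\<close> by (auto simp: superlevel_def space_pair_measure)
    show "emeasure lborel (Pair \<omega> -` {p\<in>space (M \<Otimes>\<^sub>M lborel). \<exists>t\<in>K. h + t \<in> superlevel Y p}) = ennreal ?m"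
      unfolding eq by (cases "0 \<le> ?m") (simp_all add: ennreal_neg)
  qed
  finally show ?thesis .
qed

lemma emeasure_superlevel_meets_unit_cube:
  "emeasure (M \<Otimes>\<^sub>M lborel) {p\<in>space (M \<Otimes>\<^sub>M lborel). 0 < S.vol 0 (cbox 0 (vec 1)) p} \<le>
    (\<integral>\<^sup>+\<omega>. (SUP t\<in>cbox 0 (vec 1). ennreal (Y t \<omega>)) \<partial>M)" (is "emeasure _ ?E \<le> _")
proof -
  have "emeasure (M \<Otimes>\<^sub>M lborel) ?E = (\<integral>\<^sup>+\<omega>. emeasure lborel (Pair \<omega> -` ?E) \<partial>M)"
    by (rule lborel.emeasure_pair_measure_alt) measurable
  also have "\<dots> \<le> (\<integral>\<^sup>+\<omega>. (SUP t\<in>cbox 0 (vec 1). ennreal (Y t \<omega>)) \<partial>M)"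
  proof (rule nn_integral_mono)
    fix \<omega>
    show "emeasure lborel (Pair \<omega> -` ?E) \<le> (SUP t\<in>cbox 0 (vec 1). ennreal (Y t \<omega>))" (is "_ \<le> ?S")
    proof (cases ?S)
      case (real r)
      have "Pair \<omega> -` ?E \<subseteq> {0..r}"
      proof
        fix s assume "s \<in> Pair \<omega> -` ?E"
        then have "S.vol 0 (cbox 0 (vec 1)) (\<omega>, s) \<noteq> 0" by auto
        then have "cbox 0 (vec 1) \<inter> superlevel Y (\<omega>, s) \<noteq> {}" by (auto simp: S.vol_eq_emeasure)
        then obtain t where t: "t \<in> cbox 0 (vec 1)" "0 < s" "s < Y t \<omega>" by (auto simp: superlevel_def)
        have "ennreal s \<le> ennreal (Y t \<omega>)" using t by (intro ennreal_leI) simp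
        also have "\<dots> \<le> ?S" using t(1) by (rule SUP_upper)
        finally show "s \<in> {0..r}" using t real by simp
      qed
      then have "emeasure lborel (Pair \<omega> -` ?E) \<le> emeasure lborel {0..r}"
        by (intro emeasure_mono) auto
      then show ?thesis using real by simp
    next
      case top
      show ?thesis unfolding top by (rule top_greatest)
    qed
  qed
  finally show ?thesis .
qed

lemma emeasure_superlevel_volume_eq:
  "emeasure (M \<Otimes>\<^sub>M lborel) {p\<in>space (M \<Otimes>\<^sub>M lborel). 0 \<in> superlevel Y p \<and> S.vol 0 UNIV p = ennreal x} = 0"
    (is "emeasure _ ?E = 0")
proof -
  have "emeasure (M \<Otimes>\<^sub>M lborel) ?E = (\<integral>\<^sup>+\<omega>. emeasure lborel (Pair \<omega> -` ?E) \<partial>M)"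
    by (rule lborel.emeasure_pair_measure_alt) measurable
  also have "\<dots> = (\<integral>\<^sup>+\<omega>. 0 \<partial>M)"
  proof (rule nn_integral_cong)
    fix \<omega>
    have vol: "emeasure lborel {t. s < Y t \<omega>} = ennreal x" "0 < s" "s < Y 0 \<omega>"
      if "s \<in> Pair \<omega> -` ?E" for s
      using that by (auto simp: S.vol_eq_emeasure superlevel_def)
    have unique: "\<not> s < s'" if "s \<in> Pair \<omega> -` ?E" "s' \<in> Pair \<omega> -` ?E" for s s'
      using superlevel_volume_strict_mono[OF Y_continuous[of \<omega>], of s s'] vol[OF that(1)] vol[OF that(2)]
      by auto
    have "\<exists>s. Pair \<omega> -` ?E \<subseteq> {s}"
    proof (cases "Pair \<omega> -` ?E = {}")
      case False
      then obtain s where s: "s \<in> Pair \<omega> -` ?E" by blast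
      have "s' = s" if "s' \<in> Pair \<omega> -` ?E" for s'
        using unique[OF that s] unique[OF s that] by linarith
      then show ?thesis by (intro exI[of _ s] subsetI) (simp only: singleton_iff)
    qed auto
    then obtain s where "Pair \<omega> -` ?E \<subseteq> {s}" ..
    then have "emeasure lborel (Pair \<omega> -` ?E) \<le> emeasure lborel {s}"
      by (intro emeasure_mono) auto
    then show "emeasure lborel (Pair \<omega> -` ?E) = 0" by simp
  qed
  finally show ?thesis by simp
qed

lemma set_lebesgue_integral_indicator_less_iff:
  fixes C S :: "(real^'n) set"
  assumes "C \<in> sets borel" "S \<in> sets borel" "emeasure lborel C < \<infinity>" "0 \<le> x"
  shows "x < (LBINT t:C. indicator S t) \<longleftrightarrow> ennreal x < emeasure lborel (C \<inter> S)"
proof -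
  have "emeasure lborel (C \<inter> S) \<le> emeasure lborel C"
    using assms by (intro emeasure_mono) auto
  then have fin: "emeasure lborel (C \<inter> S) = ennreal (measure lborel (C \<inter> S))"
    using assms(3) by (intro emeasure_eq_ennreal_measure) (auto simp: top_unique)
  have "(LBINT t:C. indicator S t) = (\<integral>t. (indicator (C \<inter> S) t :: real) \<partial>lborel)"
    unfolding set_lebesgue_integral_def
    by (intro Bochner_Integration.integral_cong) (auto split: split_indicator)
  then show ?thesis
    using assms fin by (simp add: ennreal_less_iff)
qed

text \<open>For each positive level the completeness of \<open>M\<close> makes the event for \<open>Z\<close> measurable, as it agrees
  almost surely with the one for \<open>Y\<close>; the integral over the levels is then a Fubini integral. The
  level \<open>0\<close>, where the superlevel set of \<open>Y\<close> is empty by convention, is a single point.\<close>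

lemma integral_tail_volume_eq:
  assumes compl: "complete_measure M" and eq: "AE \<omega> in M. \<forall>t. Z t \<omega> = Y t \<omega>" and "0 \<le> x"
    and fin: "emeasure (M \<Otimes>\<^sub>M lborel) {p\<in>space (M \<Otimes>\<^sub>M lborel).
        ennreal x < S.vol 0 (cbox 0 (vec T)) p} < \<infinity>"
  shows "(LBINT s:{0..}. measure M {\<omega>\<in>space M. x < (LBINT t:cbox 0 (vec T). indicator {u. s < Z u \<omega>} t)}) =
    measure (M \<Otimes>\<^sub>M lborel) {p\<in>space (M \<Otimes>\<^sub>M lborel). ennreal x < S.vol 0 (cbox 0 (vec T)) p}"
    (is "(LBINT s:{0..}. ?f s) = measure _ ?E")
proof -
  interpret complete_measure M by fact
  interpret pair: pair_sigma_finite M lborel ..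
  let ?C = "cbox 0 (vec T) :: (real^'n) set"
  have E: "?E \<in> sets (M \<Otimes>\<^sub>M lborel)" by measurable
  define g where "g s = measure M ((\<lambda>\<omega>. (\<omega>, s)) -` ?E)" for s
  have g_meas [measurable]: "g \<in> borel_measurable borel"
    using pair.measurable_emeasure_Pair2[OF E] unfolding g_def[abs_def] measure_def by simp
  have g_nonneg: "0 \<le> g s" for s by (simp add: g_def)
  have slice: "(\<lambda>\<omega>. (\<omega>, s)) -` ?E = {\<omega>\<in>space M. ennreal x < S.vol 0 ?C (\<omega>, s)}" for s
    by (auto simp: space_pair_measure)
  have pos: "?f s = g s" if "0 < s" for s
  proof -
    have ae: "AE \<omega> in M. \<omega> \<in> (\<lambda>\<omega>. (\<omega>, s)) -` ?E \<longleftrightarrow>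
        \<omega> \<in> {\<omega>\<in>space M. x < (LBINT t:?C. indicator {u. s < Z u \<omega>} t)}"
      using eq
    proof eventually_elim
      case (elim \<omega>)
      have "superlevel Y (\<omega>, s) = {u. s < Z u \<omega>}"
        using that elim by (simp add: superlevel_def)
      moreover from this have "{u. s < Z u \<omega>} \<in> sets borel"
        using S.borel_A[of "(\<omega>, s)"] by simp
      ultimately show ?case
        using emeasure_lborel_cbox_finite[of 0 "vec T :: real^'n"] \<open>0 \<le> x\<close> unfolding slice
        by (simp add: S.vol_eq_emeasure set_lebesgue_integral_indicator_less_iff)
    qed
    have A: "(\<lambda>\<omega>. (\<omega>, s)) -` ?E \<in> sets M"
      by (rule sets_Pair2[OF E])
    have B: "{\<omega>\<in>space M. x < (LBINT t:?C. indicator {u. s < Z u \<omega>} t)} \<in> sets M"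
      by (rule in_sets_AE[OF ae A]) auto
    show ?thesis
      unfolding g_def using measure_eq_AE[OF ae A B] by simp
  qed
  have neg: "g s = 0" if "s \<le> 0" for s
  proof -
    have "superlevel Y (\<omega>, s) = {}" for \<omega> using that by (auto simp: superlevel_def)
    then have empty: "(\<lambda>\<omega>. (\<omega>, s)) -` ?E = {}" by (auto simp: slice S.vol_eq_emeasure)
    show ?thesis unfolding g_def empty by simp
  qed
  have "(LBINT s:{0..}. ?f s) = (\<integral>s. (if s = 0 then ?f 0 else g s) \<partial>lborel)"
    unfolding set_lebesgue_integral_def[of lborel "{0..} :: real set"]
  proof (intro Bochner_Integration.integral_cong refl)
    fix s :: real
    show "indicator {0..} s *\<^sub>R ?f s = (if s = 0 then ?f 0 else g s)"
      using pos[of s] neg[of s] by (cases "s = 0"; cases "0 < s"; simp)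
  qed
  also have "\<dots> = (\<integral>s. g s \<partial>lborel)"
  proof (rule integral_cong_AE)
    show "AE s in lborel. (if s = 0 then ?f 0 else g s) = g s"
      using AE_lborel_singleton[of "0::real"] by eventually_elim simp
  qed measurable
  also have "\<dots> = enn2real (\<integral>\<^sup>+s. ennreal (g s) \<partial>lborel)"
    using g_meas by (intro integral_eq_nn_integral AE_I2) (simp_all add: g_nonneg)
  also have "(\<integral>\<^sup>+s. ennreal (g s) \<partial>lborel) = emeasure (M \<Otimes>\<^sub>M lborel) ?E"
    unfolding pair.emeasure_pair_measure_alt2[OF E] g_def by (simp add: emeasure_eq_measure)
  finally show ?thesis by (simp add: measure_def)
qed

end

lemma continuous_modification:
  fixes Z :: "real^'n \<Rightarrow> 'w \<Rightarrow> real"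
  assumes "prob_space M" and "\<And>t. Z t \<in> borel_measurable M"
    and "AE \<omega> in M. continuous_on UNIV (\<lambda>t. Z t \<omega>)"
  obtains Y where "continuous_field M Y" "AE \<omega> in M. \<forall>t. Z t \<omega> = Y t \<omega>"
proof -
  obtain N where N: "N \<in> null_sets M" "{\<omega>\<in>space M. \<not> continuous_on UNIV (\<lambda>t. Z t \<omega>)} \<subseteq> N"
    using assms(3) by (auto simp: eventually_ae_filter)
  define Y where "Y t \<omega> = (if \<omega> \<in> space M - N then Z t \<omega> else 0)" for t \<omega>
  have [measurable]: "N \<in> sets M" using N(1) by auto
  have "Y t \<in> borel_measurable M" for t
    using assms(2) unfolding Y_def[abs_def] by (intro measurable_If_set) auto
  moreover have "continuous_on UNIV (\<lambda>t. Y t \<omega>)" for \<omega>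
    using N(2) by (cases "\<omega> \<in> space M - N") (auto simp: Y_def)
  ultimately have "continuous_field M Y"
    using assms(1) by (simp add: continuous_field_def continuous_field_axioms_def)
  moreover have "AE \<omega> in M. \<forall>t. Z t \<omega> = Y t \<omega>"
    using AE_not_in[OF N(1)] AE_space by eventually_elim (simp add: Y_def)
  ultimately show ?thesis by (rule that)
qed

section \<open>Continuity of the Berman function\<close>

theorem corollary2p3:
  fixes M :: "'w measure"
    and Z :: "real^'n \<Rightarrow> 'w \<Rightarrow> real"
    and V :: "nat \<Rightarrow> 'w \<Rightarrow> real"
    and Zc :: "nat \<Rightarrow> real^'n \<Rightarrow> 'w \<Rightarrow> real"
    and x0 :: real
  assumes "prob_space M" and "complete_measure M" and "nonatomic M"
    and "D_random_field M Z"
    and "\<And>t. integrable M (Z t)" and "\<And>t. (\<integral>\<omega>. Z t \<omega> \<partial>M) = 1"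
    and "\<And>T. 0 < T \<Longrightarrow> (\<integral>\<^sup>+\<omega>. (SUP t\<in>cbox 0 (vec T). ennreal (Z t \<omega>)) \<partial>M) < \<infinity>"
    and "AE \<omega> in M. 0 < (SUP t. ereal (Z t \<omega>))"
    and "iid_unit_exponential M V"
    and "iid_copies M Z Zc"
    and "indep_elements M
           (\<Pi>\<^sub>M k\<in>UNIV. borel) (\<lambda>\<omega> k. V k \<omega>)
           (\<Pi>\<^sub>M i\<in>UNIV. \<Pi>\<^sub>M t\<in>UNIV. borel) (\<lambda>\<omega> i t. Zc i t \<omega>)"
    and "stationary_field M (max_stable_field V Zc)"
    and "AE \<omega> in M. continuous_on UNIV (\<lambda>t. Z t \<omega>)"
    and "0 \<le> x0"
  shows "(berman M Z \<longlongrightarrow> berman M Z x0) (at x0 within {0..})"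
proof -
  interpret spectral_representation M Z V Zc
    using assms by (simp add: spectral_representation_def spectral_representation_axioms_def D_random_field_def)
  obtain Y where Y: "continuous_field M Y" and eq: "AE \<omega> in M. \<forall>t. Z t \<omega> = Y t \<omega>"
    using continuous_modification[OF assms(1) Z_measurable assms(13)] by blast
  interpret Y: continuous_field M Y by fact
  let ?P = "M \<Otimes>\<^sub>M lborel :: ('w \<times> real) measure"
  have hits: "emeasure ?P {p\<in>space ?P. \<exists>t\<in>K. h + t \<in> superlevel Y p} =
      (\<integral>\<^sup>+\<omega>. ennreal (Max ((\<lambda>t. Z (t + h) \<omega>) ` K)) \<partial>M)"
    if "finite K" "K \<noteq> {}" for K h
    unfolding Y.emeasure_superlevel_hits[OF that]
    using eq by (intro nn_integral_cong_AE) (auto elim!: eventually_mono)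
  interpret A: locally_finite_stationary_random_open_set ?P "superlevel Y"
  proof
    have "AE \<omega> in M. 0 \<le> Z 0 \<omega>"
      using assms(4) by (auto simp: D_random_field_def cadlag_fields_def elim!: eventually_mono)
    then show "emeasure ?P {p\<in>space ?P. 0 \<in> superlevel Y p} = 1"
      using hits[of "{0}" 0] nn_integral_eq_integral[OF assms(5)[of 0]] assms(6)[of 0] by simp
    show "emeasure ?P {p\<in>space ?P. \<exists>t\<in>K. h + t \<in> superlevel Y p} =
        emeasure ?P {p\<in>space ?P. \<exists>t\<in>K. t \<in> superlevel Y p}" if "finite K" "K \<noteq> {}" for K h
      using hits[OF that, of h] hits[OF that, of 0] nn_integral_Max_shift[OF assms(12) that assms(5), of h]
      by simp
    have "emeasure ?P {p\<in>space ?P. 0 < Y.S.vol 0 (cbox 0 (vec 1)) p} \<le>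
        (\<integral>\<^sup>+\<omega>. (SUP t\<in>cbox 0 (vec 1). ennreal (Y t \<omega>)) \<partial>M)"
      by (rule Y.emeasure_superlevel_meets_unit_cube)
    also have "\<dots> = (\<integral>\<^sup>+\<omega>. (SUP t\<in>cbox 0 (vec 1). ennreal (Z t \<omega>)) \<partial>M)"
      using eq by (intro nn_integral_cong_AE) (auto elim!: eventually_mono)
    also have "\<dots> < \<infinity>" by (rule assms(7)) simp
    finally show "emeasure ?P {p\<in>space ?P. 0 < Y.S.vol 0 (cbox 0 (vec 1)) p} < \<infinity>" .
  qed
  have berman_eq: "berman M Z x = enn2real (Y.S.palm_tail x)" if "0 \<le> x" for x
    unfolding berman_def
  proof (rule tendsto_Lim)
    show "((\<lambda>T. 1 / T ^ CARD('n) * (LBINT s:{0..}. measure M {\<omega>\<in>space M.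
        x < (LBINT t:cbox 0 (vec T). indicator {u. s < Z u \<omega>} t)})) \<longlongrightarrow> enn2real (Y.S.palm_tail x)) at_top"
    proof (rule Lim_transform_eventually[OF A.tendsto_cube_tail])
      show "\<forall>\<^sub>F T in at_top. 1 / T ^ CARD('n) *
          measure ?P {p\<in>space ?P. ennreal x < Y.S.vol 0 (cbox 0 (vec T)) p} =
          1 / T ^ CARD('n) * (LBINT s:{0..}. measure M {\<omega>\<in>space M.
          x < (LBINT t:cbox 0 (vec T). indicator {u. s < Z u \<omega>} t)})"
        using eventually_ge_at_top[of 1]
        by eventually_elim
          (simp only: Y.integral_tail_volume_eq[OF assms(2) eq that A.emeasure_vol_cube_finite])
    qed
  qed simp
  have "((\<lambda>x. enn2real (Y.S.palm_tail x)) \<longlongrightarrow> enn2real (Y.S.palm_tail x0)) (at x0 within {0..})"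
    using assms(14) Y.emeasure_superlevel_volume_eq by (rule A.palm_tail_continuous)
  then show ?thesis
    unfolding berman_eq[OF assms(14)]
    by (rule Lim_transform_eventually) (auto simp: eventually_at_filter berman_eq)
qed

end
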